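(* Let $M$ be a $(2n+1)$-dimensional smooth contact manifold. Given an arbitrary Heisenberg structure on $M$, with contact form $\alpha$ and vector fields $A_1,\dots,A_n,B_1,\dots,B_n,Z$, the contact vector field with contact Hamiltonian $H$ is given by the formula $$X_H=H\,Z-\sum_{i=1}^n\bigl(A_i(H)\,B_i-B_i(H)\,A_i\bigr).$$
   Context: A contact structure $\xi$ on a $(2n+1)$-dimensional smooth manifold $M$ ($n\ge 1$) is a completely non-integrable codimension 1 distribution; a contact form is a real 1-form $\alpha$ with $\xi=\ker\alpha$ and $\alpha\wedge(d\alpha)^n\neq0$ everywhere. The Reeb field of $\alpha$ is the vector field $Z$ with $Z\in\ker d\alpha$ and $\alpha(Z)\equiv 1$. $M$ is equipped with a Heisenberg structure if one fixes a contact form $\alpha$ on $M$ and $2n+1$ vector fields $A_1,\dots,A_n,B_1,\dots,B_n,Z$ on $M$ such that: $Z$ is the Reeb field of $\alpha$; the $2n$ vector fields $A_i,B_j$ are linearly independent at every point and tangent to the contact structure, $\alpha(A_i)=\alpha(B_j)=0$; and $[A_i,B_j]=\delta_{ij}Z$, while all other brackets are zero: $[A_i,A_j]=[B_i,B_j]=[A_i,Z]=[B_i,Z]=0$. (This is an action of the Heisenberg Lie algebra $\mathfrak{h}_n$ on $M$.) A contact vector field is a (complex) vector field $X$ with $L_X\alpha=f_X\alpha$ for some function $f_X$; its contact Hamiltonian with respect to $\alpha$ is $H=\alpha(X)$. The map $X\mapsto\alpha(X)$ is a bijection from contact vector fields onto complex-valued smooth functions, and $X_H$ denotes the contact vector field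 with contact Hamiltonian $H$. *)

theory Defs
  imports "HOL-Analysis.Analysis" "HOL-Combinatorics.Permutations"
begin

section \<open>Smooth manifolds\<close>

text \<open>
  Used for open \<open>S\<close> only. In finite dimensions a differentiable function is of class
  \<open>C\<^sup>k\<^sup>+\<^sup>1\<close> iff all its directional derivatives are of class \<open>C\<^sup>k\<close>.
\<close>

fun Ck_on :: "nat \<Rightarrow> ('e::euclidean_space \<Rightarrow> 'b::real_normed_vector) \<Rightarrow> 'e set \<Rightarrow> bool" where
  "Ck_on 0 f S \<longleftrightarrow> continuous_on S f"
| "Ck_on (Suc k) f S \<longleftrightarrow>
     f differentiable_on S \<and> (\<forall>v. Ck_on k (\<lambda>x. frechet_derivative f (at x) v) S)"

definition smooth_on :: "('e::euclidean_space \<Rightarrow> 'b::real_normed_vector) \<Rightarrow> 'e set \<Rightarrow> bool" where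
  "smooth_on f S \<longleftrightarrow> (\<forall>k. Ck_on k f S)"

text \<open>
  The manifold is the whole type \<open>'a\<close>; a chart \<open>(U, \<phi>)\<close> is a homeomorphism from an open set \<open>U\<close>
  onto an open subset of the model space \<open>'e\<close>, so that the dimension is \<open>DIM('e)\<close>.
  The atlas need not be maximal: it determines the same smooth functions as the maximal
  atlas containing it.
\<close>

type_synonym ('a, 'e) chart = "'a set \<times> ('a \<Rightarrow> 'e)"

definition smooth_atlas ::
    "('a::{t2_space, second_countable_topology}, 'e::euclidean_space) chart set \<Rightarrow> bool" where
  "smooth_atlas \<A> \<longleftrightarrow>
     (\<forall>(U, \<phi>)\<in>\<A>. open U \<and> open (\<phi> ` U) \<and> homeomorphism U (\<phi> ` U) \<phi> (inv_into U \<phi>)) \<and>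
     (\<Union>(U, \<phi>)\<in>\<A>. U) = UNIV \<and>
     (\<forall>(U, \<phi>)\<in>\<A>. \<forall>(V, \<psi>)\<in>\<A>. smooth_on (\<psi> \<circ> inv_into U \<phi>) (\<phi> ` (U \<inter> V)))"

definition smooth_fun ::
    "('a, 'e::euclidean_space) chart set \<Rightarrow> ('a \<Rightarrow> 'b::real_normed_vector) \<Rightarrow> bool" where
  "smooth_fun \<A> f \<longleftrightarrow> (\<forall>(U, \<phi>)\<in>\<A>. smooth_on (f \<circ> inv_into U \<phi>) (\<phi> ` U))"


section \<open>Vector fields and differential forms\<close>

text \<open>
  Tangent vectors at \<open>p\<close> are derivations at \<open>p\<close> of the algebra of smooth real functions. Since
  smooth functions do not form a type, a tangent vector is a function on all of
  \<open>'a \<Rightarrow> real\<close>; the value 0 on functions that are not smooth makes it unique.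
\<close>

type_synonym 'a tangent = "('a \<Rightarrow> real) \<Rightarrow> real"
type_synonym 'a vfield = "'a \<Rightarrow> 'a tangent"
type_synonym 'a form1 = "'a \<Rightarrow> 'a tangent \<Rightarrow> real"

definition tangent_space :: "('a, 'e::euclidean_space) chart set \<Rightarrow> 'a \<Rightarrow> 'a tangent set" where
  "tangent_space \<A> p = {v.
     (\<forall>f g. smooth_fun \<A> f \<longrightarrow> smooth_fun \<A> g \<longrightarrow> v (\<lambda>x. f x + g x) = v f + v g) \<and>
     (\<forall>c f. smooth_fun \<A> f \<longrightarrow> v (\<lambda>x. c * f x) = c * v f) \<and>
     (\<forall>f g. smooth_fun \<A> f \<longrightarrow> smooth_fun \<A> g \<longrightarrow> v (\<lambda>x. f x * g x) = f p * v g + g p * v f) \<and>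
     (\<forall>f. \<not> smooth_fun \<A> f \<longrightarrow> v f = 0)}"

definition vector_field :: "('a, 'e::euclidean_space) chart set \<Rightarrow> 'a vfield \<Rightarrow> bool" where
  "vector_field \<A> X \<longleftrightarrow>
     (\<forall>p. X p \<in> tangent_space \<A> p) \<and>
     (\<forall>f. smooth_fun \<A> f \<longrightarrow> smooth_fun \<A> (\<lambda>p. X p f))"

definition lie_bracket :: "'a vfield \<Rightarrow> 'a vfield \<Rightarrow> 'a vfield" where
  "lie_bracket X Y = (\<lambda>p f. X p (\<lambda>q. Y q f) - Y p (\<lambda>q. X q f))"

definition one_form :: "('a, 'e::euclidean_space) chart set \<Rightarrow> 'a form1 \<Rightarrow> bool" where
  "one_form \<A> \<alpha> \<longleftrightarrow>
     (\<forall>p. \<forall>u\<in>tangent_space \<A> p. \<forall>v\<in>tangent_space \<A> p. \<forall>a b.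
        \<alpha> p (\<lambda>f. a * u f + b * v f) = a * \<alpha> p u + b * \<alpha> p v) \<and>
     (\<forall>X. vector_field \<A> X \<longrightarrow> smooth_fun \<A> (\<lambda>p. \<alpha> p (X p)))"

text \<open>
  Forms of higher degree are regarded as alternating maps on vector fields, linear over the
  smooth functions: \<open>d\<alpha>(X, Y) = X(\<alpha>(Y)) - Y(\<alpha>(X)) - \<alpha>([X, Y])\<close>.
\<close>

definition ext_deriv :: "'a form1 \<Rightarrow> 'a vfield \<Rightarrow> 'a vfield \<Rightarrow> 'a \<Rightarrow> real" where
  "ext_deriv \<alpha> X Y p =
     X p (\<lambda>q. \<alpha> q (Y q)) - Y p (\<lambda>q. \<alpha> q (X q)) - \<alpha> p (lie_bracket X Y p)"

text \<open>
  The \<open>(2n+1)\<close>-form \<open>\<alpha> \<and> (d\<alpha>)\<^sup>n\<close> at \<open>p\<close>, evaluated on \<open>V 0, \<dots>, V (2n)\<close>. The wedge product is the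
  sum over shuffles; summing over all permutations instead counts each shuffle \<open>2\<^sup>n\<close> times.
\<close>

definition wedge_contact :: "nat \<Rightarrow> 'a form1 \<Rightarrow> (nat \<Rightarrow> 'a vfield) \<Rightarrow> 'a \<Rightarrow> real" where
  "wedge_contact n \<alpha> V p =
     (\<Sum>\<sigma> | \<sigma> permutes {..2 * n}.
        of_int (sign \<sigma>) * \<alpha> p (V (\<sigma> 0) p) *
        (\<Prod>i<n. ext_deriv \<alpha> (V (\<sigma> (2 * i + 1))) (V (\<sigma> (2 * i + 2))) p)) / 2 ^ n"

text \<open>
  Every tangent vector at \<open>p\<close> extends to a vector field, so quantifying over vector fields here
  says that the form is nonzero at \<open>p\<close>.
\<close>

definition contact_form :: "('a, 'e::euclidean_space) chart set \<Rightarrow> nat \<Rightarrow> 'a form1 \<Rightarrow> bool" where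
  "contact_form \<A> n \<alpha> \<longleftrightarrow>
     one_form \<A> \<alpha> \<and>
     (\<forall>p. \<exists>V. (\<forall>i\<le>2 * n. vector_field \<A> (V i)) \<and> wedge_contact n \<alpha> V p \<noteq> 0)"

definition contact_structure ::
    "('a, 'e::euclidean_space) chart set \<Rightarrow> 'a form1 \<Rightarrow> 'a \<Rightarrow> 'a tangent set" where
  "contact_structure \<A> \<alpha> p = {v \<in> tangent_space \<A> p. \<alpha> p v = 0}"

definition reeb_field :: "('a, 'e::euclidean_space) chart set \<Rightarrow> 'a form1 \<Rightarrow> 'a vfield \<Rightarrow> bool" where
  "reeb_field \<A> \<alpha> Z \<longleftrightarrow>
     vector_field \<A> Z \<and>
     (\<forall>Y. vector_field \<A> Y \<longrightarrow> (\<forall>p. ext_deriv \<alpha> Z Y p = 0)) \<and>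
     (\<forall>p. \<alpha> p (Z p) = 1)"


section \<open>Heisenberg structures\<close>

definition heisenberg_structure ::
    "('a, 'e::euclidean_space) chart set \<Rightarrow> nat \<Rightarrow> 'a form1 \<Rightarrow>
     (nat \<Rightarrow> 'a vfield) \<Rightarrow> (nat \<Rightarrow> 'a vfield) \<Rightarrow> 'a vfield \<Rightarrow> bool" where
  "heisenberg_structure \<A> n \<alpha> A B Z \<longleftrightarrow>
     contact_form \<A> n \<alpha> \<and>
     reeb_field \<A> \<alpha> Z \<and>
     (\<forall>i\<in>{1..n}. vector_field \<A> (A i) \<and> vector_field \<A> (B i)) \<and>
     (\<forall>p a b. (\<forall>f. (\<Sum>i=1..n. a i * A i p f + b i * B i p f) = 0) \<longrightarrow>
        (\<forall>i\<in>{1..n}. a i = (0::real) \<and> b i = 0)) \<and>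
     (\<forall>p. \<forall>i\<in>{1..n}. A i p \<in> contact_structure \<A> \<alpha> p \<and> B i p \<in> contact_structure \<A> \<alpha> p) \<and>
     (\<forall>i\<in>{1..n}. \<forall>j\<in>{1..n}.
        lie_bracket (A i) (B j) = (if i = j then Z else (\<lambda>p f. 0)) \<and>
        lie_bracket (A i) (A j) = (\<lambda>p f. 0) \<and>
        lie_bracket (B i) (B j) = (\<lambda>p f. 0)) \<and>
     (\<forall>i\<in>{1..n}.
        lie_bracket (A i) Z = (\<lambda>p f. 0) \<and>
        lie_bracket (B i) Z = (\<lambda>p f. 0))"


section \<open>Complex vector fields and contact Hamiltonians\<close>

text \<open>
  An element \<open>u + \<i>v\<close> of the complexified tangent space is identified with the complex-valued
  derivation \<open>f \<mapsto> u f + \<i> v f\<close> on smooth real functions. Real vector fields act on complex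
  functions, real forms on complex vectors, and \<open>L\<^sub>X \<alpha>\<close> depends on \<open>X\<close>, complex linearly.
\<close>

type_synonym 'a cvfield = "'a \<Rightarrow> ('a \<Rightarrow> real) \<Rightarrow> complex"

definition Re_field :: "'a cvfield \<Rightarrow> 'a vfield" where
  "Re_field X = (\<lambda>p f. Re (X p f))"

definition Im_field :: "'a cvfield \<Rightarrow> 'a vfield" where
  "Im_field X = (\<lambda>p f. Im (X p f))"

definition complex_vector_field ::
    "('a, 'e::euclidean_space) chart set \<Rightarrow> 'a cvfield \<Rightarrow> bool" where
  "complex_vector_field \<A> X \<longleftrightarrow> vector_field \<A> (Re_field X) \<and> vector_field \<A> (Im_field X)"

definition apply_field :: "'a vfield \<Rightarrow> ('a \<Rightarrow> complex) \<Rightarrow> 'a \<Rightarrow> complex" where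
  "apply_field X H p = Complex (X p (\<lambda>q. Re (H q))) (X p (\<lambda>q. Im (H q)))"

definition lie_deriv_real :: "'a vfield \<Rightarrow> 'a form1 \<Rightarrow> 'a vfield \<Rightarrow> 'a \<Rightarrow> real" where
  "lie_deriv_real X \<alpha> Y p = X p (\<lambda>q. \<alpha> q (Y q)) - \<alpha> p (lie_bracket X Y p)"

definition lie_deriv :: "'a cvfield \<Rightarrow> 'a form1 \<Rightarrow> 'a vfield \<Rightarrow> 'a \<Rightarrow> complex" where
  "lie_deriv X \<alpha> Y p =
     Complex (lie_deriv_real (Re_field X) \<alpha> Y p) (lie_deriv_real (Im_field X) \<alpha> Y p)"

definition contact_vector_field ::
    "('a, 'e::euclidean_space) chart set \<Rightarrow> 'a form1 \<Rightarrow> 'a cvfield \<Rightarrow> bool" where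
  "contact_vector_field \<A> \<alpha> X \<longleftrightarrow>
     complex_vector_field \<A> X \<and>
     (\<exists>h :: 'a \<Rightarrow> complex. \<forall>Y. vector_field \<A> Y \<longrightarrow>
        (\<forall>p. lie_deriv X \<alpha> Y p = h p * of_real (\<alpha> p (Y p))))"

definition contact_hamiltonian :: "'a form1 \<Rightarrow> 'a cvfield \<Rightarrow> 'a \<Rightarrow> complex" where
  "contact_hamiltonian \<alpha> X p = Complex (\<alpha> p (Re_field X p)) (\<alpha> p (Im_field X p))"

definition contact_field_of ::
    "('a, 'e::euclidean_space) chart set \<Rightarrow> 'a form1 \<Rightarrow> ('a \<Rightarrow> complex) \<Rightarrow> 'a cvfield" where
  "contact_field_of \<A> \<alpha> H =
     (THE X. contact_vector_field \<A> \<alpha> X \<and> contact_hamiltonian \<alpha> X = H)"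

end

theory Submission
  imports Defs
begin

text \<open>
  Since \<open>L\<^sub>X \<alpha> = \<iota>\<^sub>X d\<alpha> + d(\<alpha>(X))\<close>, a contact field with Hamiltonian \<open>H\<close> is a field \<open>X\<close> such that
  \<open>\<alpha>(X) = H\<close> and \<open>d\<alpha>(X, Y) + Y(H)\<close> is a multiple of \<open>\<alpha>(Y)\<close>. Evaluating this on \<open>Y = A\<^sub>j\<close> and
  \<open>Y = B\<^sub>j\<close>, where \<open>d\<alpha>(A\<^sub>i, B\<^sub>j) = -\<alpha>([A\<^sub>i, B\<^sub>j]) = -\<delta>\<^sub>i\<^sub>j\<close>, gives the coefficients of \<open>X\<close> in the frame
  \<open>Z, A\<^sub>i, B\<^sub>i\<close>; conversely, on an arbitrary \<open>Y\<close> the field found in this way yields \<open>Z(H) \<alpha>(Y)\<close>. Two facts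
  make it legitimate to compute pointwise in the frame: tangent spaces, being spaces of derivations,
  have dimension \<open>2n + 1\<close> (Hadamard's lemma in a chart), and \<open>d\<alpha>\<close>, defined on vector fields, is
  tensorial.
\<close>

text \<open>Two features of the definitions shape the proof. Tangent vectors act on globally smooth
  functions and a priori know nothing of charts, so a chart, or a function living in one, must be
  cut off and extended to the whole space before a tangent vector can be applied to it; hence bump
  functions precede the study of tangent spaces. And \<open>Ck_on\<close> recurses through
  derivatives in fixed directions, so closure properties of smooth maps are inductions on the order
  whose step must express the derivative through functions already covered. The coefficients of a
  field in the Heisenberg frame are found at one point at a time, with no smoothness in the point,
  so they cannot simply be pulled out of \<open>ext_deriv\<close>, which differentiates. The detour
  is a coordinate frame, where coefficients are values of the field on extended coordinate
  functions. The same coordinates embed the tangent space in the model space, and there a dimension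
  count turns independence of the frame into spanning.\<close>

section \<open>Calculus of smooth maps\<close>

lemma differentiable_on_openD:
  assumes "f differentiable_on S" and "open S" and "x \<in> S"
  shows "(f has_derivative frechet_derivative f (at x)) (at x)"
  using assms at_within_open differentiable_on_def frechet_derivative_works by metis

lemma differentiable_on_has_derivativeI:
  assumes "\<And>x. x \<in> S \<Longrightarrow> (f has_derivative f' x) (at x)"
  shows "f differentiable_on S"
  by (meson assms differentiableI differentiable_at_imp_differentiable_on)

text \<open>\<open>frechet_derivative f (at x)\<close> sees a full neighbourhood of
  \<open>x\<close>; openness of \<open>S\<close> is what makes agreement on \<open>S\<close> pass to
  the derivatives and so drives the induction.\<close>

lemma Ck_on_cong:
  assumes "open S" and "\<And>x. x \<in> S \<Longrightarrow> f x = g x" and "Ck_on k f S"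
  shows "Ck_on k g S"
  using assms(2,3)
proof (induction k arbitrary: f g)
  case 0
  then show ?case by (metis Ck_on.simps(1) continuous_on_eq)
next
  case (Suc k)
  have fd: "(f has_derivative frechet_derivative f (at x)) (at x)" if "x \<in> S" for x
    by (rule differentiable_on_openD[OF _ assms(1) that]) (use Suc.prems(2) in simp)
  have gd: "(g has_derivative frechet_derivative f (at x)) (at x)" if "x \<in> S" for x
    by (rule has_derivative_transform_within_open[OF fd[OF that] assms(1) that]) (use Suc.prems in auto)
  have eq: "frechet_derivative g (at x) = frechet_derivative f (at x)" if "x \<in> S" for x
    using gd[OF that] frechet_derivative_at by metis
  have "g differentiable_on S"
    using gd by (rule differentiable_on_has_derivativeI)
  moreover have "Ck_on k (\<lambda>x. frechet_derivative g (at x) v) S" for v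
    by (rule Suc.IH[of "\<lambda>x. frechet_derivative f (at x) v"]) (use eq Suc.prems in auto)
  ultimately show ?case by simp
qed

text \<open>Derivatives at a point are unique, so any \<open>f'\<close> produced by the derivative
  rules may replace the one chosen by \<open>frechet_derivative\<close>. The inductive steps below
  rely on this form.\<close>

lemma Ck_on_SucI:
  assumes "open S" and "\<And>x. x \<in> S \<Longrightarrow> (f has_derivative f' x) (at x)"
    and "\<And>v. Ck_on k (\<lambda>x. f' x v) S"
  shows "Ck_on (Suc k) f S"
proof -
  have "f differentiable_on S"
    using assms(2) by (rule differentiable_on_has_derivativeI)
  moreover have "Ck_on k (\<lambda>x. frechet_derivative f (at x) v) S" for v
    by (rule Ck_on_cong[OF assms(1) _ assms(3)[of v]])
      (use assms(2) frechet_derivative_at in metis)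
  ultimately show ?thesis by simp
qed

lemma Ck_on_SucD:
  assumes "Ck_on (Suc k) f S" and "open S" and "x \<in> S"
  shows "(f has_derivative frechet_derivative f (at x)) (at x)"
  using assms differentiable_on_openD by auto

lemma Ck_on_Suc_imp:
  assumes "Ck_on (Suc k) f S"
  shows "Ck_on k f S"
  using assms
proof (induction k arbitrary: f)
  case 0
  then show ?case by (auto intro: differentiable_imp_continuous_on)
next
  case (Suc k)
  have "f differentiable_on S" and "Ck_on (Suc k) (\<lambda>x. frechet_derivative f (at x) v) S" for v
    using Suc.prems by simp_all
  then show ?case using Suc.IH by auto
qed

lemma Ck_on_subset:
  assumes "Ck_on k f S" and "T \<subseteq> S"
  shows "Ck_on k f T"
  using assms
  by (induction k arbitrary: f) (auto intro: continuous_on_subset differentiable_on_subset)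

lemma Ck_on_local:
  assumes "open S" and "\<And>x. x \<in> S \<Longrightarrow> \<exists>T. open T \<and> x \<in> T \<and> Ck_on k f T"
  shows "Ck_on k f S"
  using assms(2)
proof (induction k arbitrary: f)
  case 0
  have "isCont f x" if "x \<in> S" for x
    using 0[OF that] continuous_on_eq_continuous_at by auto
  then show ?case by (simp add: continuous_at_imp_continuous_on)
next
  case (Suc k)
  have "f differentiable (at x)" if x: "x \<in> S" for x
    using Suc.prems[OF x] differentiable_on_openD differentiableI Ck_on.simps(2) by metis
  then have "f differentiable_on S"
    by (simp add: differentiable_at_imp_differentiable_on)
  moreover have "Ck_on k (\<lambda>x. frechet_derivative f (at x) v) S" for v
  proof (rule Suc.IH)
    fix x assume "x \<in> S"
    then obtain T where "open T" "x \<in> T" "Ck_on (Suc k) f T" using Suc.prems by blast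
    then show "\<exists>T. open T \<and> x \<in> T \<and> Ck_on k (\<lambda>x. frechet_derivative f (at x) v) T"
      by auto
  qed
  ultimately show ?case by simp
qed

lemma Ck_on_const:
  assumes "open S"
  shows "Ck_on k (\<lambda>x. c) S"
proof (induction k arbitrary: c)
  case (Suc k)
  show ?case by (rule Ck_on_SucI[OF assms, where f' = "\<lambda>_ _. 0"]) (auto intro: Suc)
qed auto

lemma Ck_on_linear:
  assumes "open S" and "bounded_linear L" and "Ck_on k f S"
  shows "Ck_on k (\<lambda>x. L (f x)) S"
  using assms(3)
proof (induction k arbitrary: f)
  case 0
  then show ?case by (simp add: bounded_linear.continuous_on[OF assms(2)])
next
  case (Suc k)
  show ?case
    by (rule Ck_on_SucI[OF assms(1)
          bounded_linear.has_derivative[OF assms(2) Ck_on_SucD[OF Suc.prems assms(1)]]])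
       (use Suc in auto)
qed

lemma Ck_on_id:
  assumes "open S"
  shows "Ck_on k (\<lambda>x. x) S"
proof (cases k)
  case (Suc k)
  show ?thesis unfolding Suc
    by (rule Ck_on_SucI[OF assms, where f' = "\<lambda>_ v. v"]) (auto intro: Ck_on_const assms)
qed auto

lemma Ck_on_add:
  assumes "open S" and "Ck_on k f S" and "Ck_on k g S"
  shows "Ck_on k (\<lambda>x. f x + g x) S"
  using assms(2,3)
proof (induction k arbitrary: f g)
  case 0
  then show ?case by (auto intro: continuous_intros)
next
  case (Suc k)
  show ?case
    by (rule Ck_on_SucI[OF assms(1) has_derivative_add[OF Ck_on_SucD[OF Suc.prems(1) assms(1)]
         Ck_on_SucD[OF Suc.prems(2) assms(1)]]]) (use Suc in auto)
qed

text \<open>The Leibniz rule differentiates one factor and keeps the other, so the induction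
  hypothesis meets one factor that has lost an order and one that has not;
  \<open>Ck_on_Suc_imp\<close> lowers the latter. A general bilinear map covers products, scalar
  multiples and inner products at once.\<close>

lemma Ck_on_bilinear:
  assumes "open S" and bl: "bounded_bilinear m" and "Ck_on k f S" and "Ck_on k g S"
  shows "Ck_on k (\<lambda>x. m (f x) (g x)) S"
  using assms(3,4)
proof (induction k arbitrary: f g)
  case 0
  then show ?case by (auto intro: bounded_bilinear.continuous_on[OF bl])
next
  case (Suc k)
  show ?case
  proof (rule Ck_on_SucI[OF assms(1) bounded_bilinear.FDERIV[OF bl
          Ck_on_SucD[OF Suc.prems(1) assms(1)] Ck_on_SucD[OF Suc.prems(2) assms(1)]]])
    fix v
    show "Ck_on k (\<lambda>x. m (f x) (frechet_derivative g (at x) v) +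
        m (frechet_derivative f (at x) v) (g x)) S"
      by (rule Ck_on_add[OF assms(1) Suc.IH[OF Ck_on_Suc_imp] Suc.IH[OF _ Ck_on_Suc_imp]])
        (use Suc.prems in simp_all)
  qed
qed

lemma Ck_on_sum:
  assumes "open S" and "finite I" and "\<And>i. i \<in> I \<Longrightarrow> Ck_on k (f i) S"
  shows "Ck_on k (\<lambda>x. \<Sum>i\<in>I. f i x) S"
  using assms(2,3)
  by (induction I rule: finite_induct) (auto intro: Ck_on_const Ck_on_add assms(1))

text \<open>In the chain rule the direction fed to the derivative of \<open>g\<close> is
  \<open>frechet_derivative f (at x) v\<close>, which moves with \<open>x\<close>, whereas
  \<open>Ck_on\<close> speaks of fixed directions. Expanding it in \<open>Basis\<close> leaves
  derivatives of \<open>g\<close> in fixed directions, to which the induction hypothesis applies,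
  times coordinates of the derivative of \<open>f\<close>.\<close>

lemma Ck_on_compose:
  fixes f :: "'d::euclidean_space \<Rightarrow> 'e::euclidean_space"
  assumes "open S" and "open T" and "f ` S \<subseteq> T" and "Ck_on k g T" and "Ck_on k f S"
  shows "Ck_on k (\<lambda>x. g (f x)) S"
  using assms(4,5)
proof (induction k arbitrary: g)
  case 0
  then show ?case using assms(3) continuous_on_compose2 by auto
next
  case (Suc k)
  let ?h = "\<lambda>x v. \<Sum>b\<in>Basis. (frechet_derivative f (at x) v \<bullet> b) *\<^sub>R
              frechet_derivative g (at (f x)) b"
  show ?case
  proof (rule Ck_on_SucI[OF assms(1), where f' = ?h])
    fix x assume x: "x \<in> S"
    have g: "(g has_derivative frechet_derivative g (at (f x))) (at (f x))"
      by (rule Ck_on_SucD[OF Suc.prems(1) assms(2)]) (use x assms(3) in auto)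
    have lin: "linear (frechet_derivative g (at (f x)))"
      using g has_derivative_linear by blast
    have "frechet_derivative g (at (f x)) w =
        (\<Sum>b\<in>Basis. (w \<bullet> b) *\<^sub>R frechet_derivative g (at (f x)) b)" for w
      using euclidean_representation[of w] linear_sum[OF lin] linear_scale[OF lin]
      by (metis (no_types, lifting) sum.cong)
    then have "?h x = (\<lambda>v. frechet_derivative g (at (f x)) (frechet_derivative f (at x) v))"
      by (intro ext) (rule sym)
    then show "((\<lambda>x. g (f x)) has_derivative ?h x) (at x)"
      using has_derivative_compose[OF Ck_on_SucD[OF Suc.prems(2) assms(1) x] g] by (simp only:)
  next
    fix v
    have "Ck_on k (\<lambda>x. frechet_derivative g (at (f x)) b) S" for b
      by (rule Suc.IH[OF _ Ck_on_Suc_imp[OF Suc.prems(2)]]) (use Suc.prems(1) in simp)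
    moreover have "Ck_on k (\<lambda>x. frechet_derivative f (at x) v \<bullet> b) S" for b
      by (rule Ck_on_linear[OF assms(1) bounded_linear_inner_left]) (use Suc.prems(2) in simp)
    ultimately show "Ck_on k (\<lambda>x. ?h x v) S"
      by (intro Ck_on_sum[OF assms(1)] Ck_on_bilinear[OF assms(1) bounded_bilinear_scaleR]) simp_all
  qed
qed

section \<open>Smooth cutoff functions on Euclidean space\<close>

lemma Ck_on_inverse: "Ck_on k inverse ({0<..} :: real set)"
proof (induction k)
  case 0
  then show ?case by (auto intro!: continuous_intros)
next
  case (Suc k)
  show ?case
    by (rule Ck_on_SucI[where f' = "\<lambda>x v. - (inverse x * v * inverse x)"])
      (auto intro!: derivative_eq_intros Ck_on_bilinear[OF _ bounded_bilinear_mult]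
        Ck_on_linear[OF _ bounded_linear_minus[OF bounded_linear_ident]] Suc Ck_on_const)
qed

text \<open>The classical flat function is the case \<open>m = 0\<close>. The powers in the
  denominator are there because differentiation leads away from \<open>m = 0\<close> but stays in
  the linear span of the family, which makes an induction on the order of smoothness
  possible.\<close>

definition flat_exp :: "nat \<Rightarrow> real \<Rightarrow> real" where
  "flat_exp m t = (if t > 0 then exp (- 1 / t) / t ^ m else 0)"

lemma flat_exp_deriv:
  "(flat_exp m has_real_derivative flat_exp (m + 2) t - m * flat_exp (m + 1) t) (at t)"
proof -
  consider "t > 0" | "t = 0" | "t < 0" by linarith
  then show ?thesis
  proof cases
    case 1
    have "((\<lambda>t. exp (- 1 / t) / t ^ m) has_real_derivative
        flat_exp (m + 2) t - m * flat_exp (m + 1) t) (at t)"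
    proof (cases m)
      case 0
      then show ?thesis
        using 1 by (auto intro!: derivative_eq_intros simp: flat_exp_def power2_eq_square)
    next
      case (Suc j)
      show ?thesis unfolding Suc
        using 1 by (auto intro!: derivative_eq_intros
            simp: flat_exp_def divide_simps simp del: power_Suc) (auto simp: algebra_simps)
    qed
    then show ?thesis
      by (rule has_field_derivative_transform_within_open[of _ _ _ "{0<..}"])
        (use 1 in \<open>auto simp: flat_exp_def\<close>)
  next
    case 2
    have "((\<lambda>h. flat_exp m h / h) \<longlongrightarrow> 0) (at_right 0)"
    proof (rule Lim_transform_eventually)
      show "((\<lambda>h. exp (- 1 / h) / h ^ m / h) \<longlongrightarrow> 0) (at_right (0::real))"
      proof (rule Lim_transform_eventually)
        \<comment> \<open>With s = 1 / h this is the limit of s ^ (m + 1) / exp s at infinity: the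
          exponential absorbs the pole of the difference quotient.\<close>
        show "((\<lambda>h. inverse h ^ Suc m / exp (inverse h)) \<longlongrightarrow> 0) (at_right (0::real))"
          by (rule filterlim_compose[OF tendsto_power_div_exp_0 filterlim_inverse_at_top_right])
      qed (auto simp: eventually_at_filter exp_minus divide_simps)
    qed (auto simp: flat_exp_def eventually_at_filter)
    moreover have "((\<lambda>h. flat_exp m h / h) \<longlongrightarrow> 0) (at_left 0)"
      by (rule tendsto_eventually) (auto simp: flat_exp_def eventually_at_filter)
    ultimately have "((\<lambda>h. flat_exp m h / h) \<longlongrightarrow> 0) (at 0)"
      by (simp add: filterlim_split_at)
    then show ?thesis using 2 by (simp add: DERIV_def flat_exp_def)
  next
    case 3
    have "((\<lambda>t. 0) has_real_derivative flat_exp (m + 2) t - m * flat_exp (m + 1) t) (at t)"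
      using 3 by (simp add: flat_exp_def)
    then show ?thesis
      by (rule has_field_derivative_transform_within_open[of _ _ _ "{..<0}"])
        (use 3 in \<open>auto simp: flat_exp_def\<close>)
  qed
qed

lemma Ck_on_flat_exp: "Ck_on k (flat_exp m) UNIV"
proof (induction k arbitrary: m)
  case 0
  have "isCont (flat_exp m) t" for t
    using flat_exp_deriv by (rule DERIV_isCont)
  then show ?case by (simp add: continuous_at_imp_continuous_on)
next
  case (Suc k)
  have "Ck_on k (\<lambda>x. flat_exp (m + 2) x * v + (- (m * v)) * flat_exp (m + 1) x) UNIV" for v :: real
    by (intro Ck_on_add Ck_on_bilinear[OF _ bounded_bilinear_mult] Suc Ck_on_const) auto
  then have "Ck_on k (\<lambda>x. (flat_exp (m + 2) x - m * flat_exp (m + 1) x) * v) UNIV" for v :: real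
    by (simp add: algebra_simps)
  then show ?case
    by (intro Ck_on_SucI[OF open_UNIV flat_exp_deriv[unfolded has_field_derivative_def]])
qed

lemma flat_exp_pos: "t > 0 \<Longrightarrow> flat_exp m t > 0"
  and flat_exp_nonneg: "flat_exp m t \<ge> 0"
  by (auto simp: flat_exp_def)

text \<open>Equal to 1 on the ball of radius \<open>r / 2\<close> about \<open>a\<close> and to 0 outside the ball of radius \<open>r\<close>.\<close>

definition plateau :: "'e::euclidean_space \<Rightarrow> real \<Rightarrow> 'e \<Rightarrow> real" where
  "plateau a r y =
     flat_exp 0 (r\<^sup>2 - (norm (y - a))\<^sup>2) *
     inverse (flat_exp 0 (r\<^sup>2 - (norm (y - a))\<^sup>2) + flat_exp 0 ((norm (y - a))\<^sup>2 - (r / 2)\<^sup>2))"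

lemma plateau_eq_1:
  assumes "r > 0" and "norm (y - a) < r / 2"
  shows "plateau a r y = 1"
proof -
  have "(norm (y - a))\<^sup>2 < (r / 2)\<^sup>2" using assms by (intro power_strict_mono) auto
  moreover have "(r / 2)\<^sup>2 < r\<^sup>2" using assms by (intro power_strict_mono) auto
  ultimately show ?thesis by (simp add: plateau_def flat_exp_def)
qed

lemma plateau_eq_0:
  assumes "r > 0" and "norm (y - a) \<ge> r"
  shows "plateau a r y = 0"
proof -
  have "(norm (y - a))\<^sup>2 \<ge> r\<^sup>2" using assms by (intro power_mono) auto
  then show ?thesis by (simp add: plateau_def flat_exp_def)
qed

lemma smooth_on_plateau:
  assumes "r > 0"
  shows "smooth_on (plateau a r) UNIV"
  unfolding smooth_on_def
proof
  fix k
  have "Ck_on k (\<lambda>y. (y - a) \<bullet> (y - a)) UNIV"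
    using Ck_on_add[OF open_UNIV Ck_on_id Ck_on_const[of _ _ "- a"]]
    by (intro Ck_on_bilinear[OF _ bounded_bilinear_inner]) auto
  then have sq: "Ck_on k (\<lambda>y. (norm (y - a))\<^sup>2) UNIV"
    by (simp add: power2_norm_eq_inner)
  have "Ck_on k (\<lambda>y. r\<^sup>2 + - ((norm (y - a))\<^sup>2)) UNIV"
    by (intro Ck_on_add Ck_on_const Ck_on_linear[OF _ bounded_linear_minus[OF bounded_linear_ident]] sq) auto
  then have f: "Ck_on k (\<lambda>y. flat_exp 0 (r\<^sup>2 - (norm (y - a))\<^sup>2)) UNIV"
    by (intro Ck_on_compose[OF _ _ _ Ck_on_flat_exp]) auto
  have "Ck_on k (\<lambda>y. (norm (y - a))\<^sup>2 + - (r / 2)\<^sup>2) UNIV"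
    by (intro Ck_on_add Ck_on_const sq) auto
  then have g: "Ck_on k (\<lambda>y. flat_exp 0 ((norm (y - a))\<^sup>2 - (r / 2)\<^sup>2)) UNIV"
    by (intro Ck_on_compose[OF _ _ _ Ck_on_flat_exp]) auto
  \<comment> \<open>The radii \<open>r / 2 < r\<close> keep the zero sets of the two summands apart:
    \<open>t \<ge> r\<^sup>2\<close> forces \<open>t > (r / 2)\<^sup>2\<close>. So the denominator
    of the plateau function never vanishes.\<close>
  have pos: "flat_exp 0 (r\<^sup>2 - t) + flat_exp 0 (t - (r / 2)\<^sup>2) > 0" for t
  proof (cases "t < r\<^sup>2")
    case True
    then show ?thesis by (intro add_pos_nonneg flat_exp_pos flat_exp_nonneg) auto
  next
    case False
    moreover have "(r / 2)\<^sup>2 < r\<^sup>2" using assms by (intro power_strict_mono) auto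
    ultimately show ?thesis by (intro add_nonneg_pos flat_exp_pos flat_exp_nonneg) auto
  qed
  show "Ck_on k (plateau a r) UNIV"
    unfolding plateau_def
    by (intro Ck_on_bilinear[OF _ bounded_bilinear_mult] f
        Ck_on_compose[OF _ _ _ Ck_on_inverse] Ck_on_add g) (use pos in auto)
qed

section \<open>Differentiation under the integral sign and Hadamard's lemma\<close>

text \<open>
  The factor \<open>t ^ m\<close> makes the induction on \<open>k\<close> work: differentiating in \<open>x\<close> raises \<open>m\<close> by one.
\<close>

lemma Ck_on_segment_integral:
  fixes h :: "'e::euclidean_space \<Rightarrow> real"
  assumes S: "open S" "convex S" "a \<in> S" and "Ck_on k h S"
  shows "Ck_on k (\<lambda>x. integral {0..1} (\<lambda>t. t ^ m * h (a + t *\<^sub>R (x - a)))) S"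
proof -
  have seg: "a + t *\<^sub>R (x - a) \<in> S" if "x \<in> S" "t \<in> {0..1}" for x t
  proof -
    have "(1 - t) *\<^sub>R a + t *\<^sub>R x \<in> S" using S that by (intro convexD) auto
    then show ?thesis by (simp add: algebra_simps)
  qed
  have cont: "continuous_on (S \<times> cbox 0 1) (\<lambda>(x, t). t ^ m * g (a + t *\<^sub>R (x - a)))"
    if "continuous_on S g" for g :: "'e \<Rightarrow> real" and m
    unfolding case_prod_beta
    by (intro continuous_intros continuous_on_compose2[OF that]) (use seg in auto)
  show ?thesis
    using assms(4)
  proof (induction k arbitrary: h m)
    case 0
    then show ?case
      using integral_continuous_on_param[OF cont[of h m]] by simp
  next
    case (Suc k)
    let ?D = "\<lambda>x t v. t ^ Suc m * frechet_derivative h (at (a + t *\<^sub>R (x - a))) v"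
    let ?B = "\<lambda>x t. Blinfun (?D x t)"
    have contd: "continuous_on S (\<lambda>x. frechet_derivative h (at x) v)" for v
      using Suc.prems by (cases k) (auto intro: differentiable_imp_continuous_on)
    have D: "((\<lambda>x. t ^ m * h (a + t *\<^sub>R (x - a))) has_derivative ?D x t) (at x)"
      if "x \<in> S" "t \<in> cbox 0 1" for x t
    proof -
      have "a + t *\<^sub>R (x - a) \<in> S" using seg that by simp
      note h = Ck_on_SucD[OF Suc.prems S(1) this]
      have "((\<lambda>x. h (a + t *\<^sub>R (x - a))) has_derivative
          (\<lambda>v. frechet_derivative h (at (a + t *\<^sub>R (x - a))) (t *\<^sub>R v))) (at x)"
        by (rule has_derivative_compose[where f = "\<lambda>x. a + t *\<^sub>R (x - a)", OF _ h]) (auto intro!: derivative_eq_intros)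
      moreover have "frechet_derivative h (at (a + t *\<^sub>R (x - a))) (t *\<^sub>R v) =
          t * frechet_derivative h (at (a + t *\<^sub>R (x - a))) v" for v
        using linear_scale[OF has_derivative_linear[OF h]] by simp
      ultimately have "((\<lambda>x. h (a + t *\<^sub>R (x - a))) has_derivative
          (\<lambda>v. t * frechet_derivative h (at (a + t *\<^sub>R (x - a))) v)) (at x)"
        by simp
      from has_derivative_mult_right[OF this, of "t ^ m"] show ?thesis
        by (simp add: mult.assoc mult.left_commute)
    qed
    have B: "blinfun_apply (?B x t) = ?D x t" if "x \<in> S" "t \<in> cbox 0 1" for x t
      using D[OF that] by (intro bounded_linear_Blinfun_apply has_derivative_bounded_linear)
    \<comment> \<open>\<open>leibniz_rule\<close> asks for a derivative that is continuous as a map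
      into bounded linear functions. In finite dimensions this may be tested on basis vectors, and
      \<open>Ck_on\<close> supplies continuity direction by direction.\<close>
    have contB: "continuous_on (S \<times> cbox 0 1) (\<lambda>(x, t). ?B x t)"
    proof (rule continuous_on_blinfun_componentwise)
      fix i :: 'e
      show "continuous_on (S \<times> cbox 0 1) (\<lambda>z. blinfun_apply (case z of (x, t) \<Rightarrow> ?B x t) i)"
        by (rule continuous_on_eq[OF cont[OF contd[of i], of "Suc m"]]) (use B in auto)
    qed
    have leib: "((\<lambda>x. integral (cbox 0 1) (\<lambda>t. t ^ m * h (a + t *\<^sub>R (x - a)))) has_derivative
        blinfun_apply (integral (cbox 0 1) (?B x))) (at x)" if x: "x \<in> S" for x
    proof -
      have "((\<lambda>x. integral (cbox 0 1) (\<lambda>t. t ^ m * h (a + t *\<^sub>R (x - a)))) has_derivative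
        blinfun_apply (integral (cbox 0 1) (?B x))) (at x within S)"
      proof (rule leibniz_rule[OF _ _ contB x S(2)])
        show "((\<lambda>x. t ^ m * h (a + t *\<^sub>R (x - a))) has_derivative blinfun_apply (?B x t)) (at x within S)"
          if "x \<in> S" "t \<in> cbox 0 1" for x t
          unfolding B[OF that] by (rule has_derivative_at_withinI[OF D[OF that]])
        have ch: "continuous_on S h"
          using Suc.prems by (auto intro: differentiable_imp_continuous_on)
        show "(\<lambda>t. t ^ m * h (a + t *\<^sub>R (x - a))) integrable_on cbox 0 1" if "x \<in> S" for x
          by (intro integrable_continuous continuous_intros continuous_on_compose2[OF ch])
            (use seg that in auto)
      qed
      then show ?thesis using at_within_open[OF x S(1)] by simp
    qed
    have app: "blinfun_apply (integral (cbox 0 1) (?B x)) v = integral {0..1} (\<lambda>t. ?D x t v)"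
      if x: "x \<in> S" for x v
    proof -
      have "continuous_on (cbox 0 1) (\<lambda>t. (\<lambda>(x, t). ?B x t) (x, t))"
        by (rule continuous_on_compose2[OF contB, where f = "\<lambda>t. (x, t)"])
          (use x in \<open>auto intro!: continuous_intros\<close>)
      then have "continuous_on (cbox 0 1) (?B x)" by simp
      then have "blinfun_apply (integral (cbox 0 1) (?B x)) v =
          integral (cbox 0 1) (\<lambda>t. blinfun_apply (?B x t) v)"
        by (intro blinfun_apply_integral integrable_continuous)
      also have "\<dots> = integral (cbox 0 1) (\<lambda>t. ?D x t v)"
        by (rule integral_cong) (use B x in auto)
      finally show ?thesis by simp
    qed
    show ?case
    proof (rule Ck_on_SucI[OF S(1) leib[unfolded box_real]])
      fix v
      have "Ck_on k (\<lambda>x. integral {0..1} (\<lambda>t. ?D x t v)) S"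
        by (rule Suc.IH) (use Suc.prems in simp)
      then show "Ck_on k (\<lambda>x. blinfun_apply (integral {0..1} (?B x)) v) S"
        by (rule Ck_on_cong[OF S(1), rotated]) (use app in simp)
    qed
  qed
qed

text \<open>The fundamental theorem of calculus along the segment from \<open>a\<close> to
  \<open>x\<close>, which convexity keeps inside \<open>S\<close>, gives \<open>f x - f a\<close> as
  the integral of the derivative in direction \<open>x - a\<close>. Splitting this direction in
  \<open>Basis\<close> leaves partial derivatives averaged over the segment: these are the
  \<open>g b\<close>. For \<open>x = a\<close> the integrand is constant.\<close>

lemma smooth_on_hadamard:
  fixes f :: "'e::euclidean_space \<Rightarrow> real"
  assumes S: "open S" "convex S" "a \<in> S" and f: "smooth_on f S"
  obtains g where "\<And>b. smooth_on (g b) S"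
    and "\<And>x. x \<in> S \<Longrightarrow> f x = f a + (\<Sum>b\<in>Basis. ((x - a) \<bullet> b) * g b x)"
    and "\<And>b. g b a = frechet_derivative f (at a) b"
proof
  \<comment> \<open>The factor \<open>t ^ 0\<close> makes this an instance of
    \<open>Ck_on_segment_integral\<close> with \<open>m = 0\<close>.\<close>
  define g where "g b x = integral {0..1} (\<lambda>t. t ^ 0 * frechet_derivative f (at (a + t *\<^sub>R (x - a))) b)" for b x
  have f1: "Ck_on (Suc k) f S" for k using f by (simp only: smooth_on_def)
  show "smooth_on (g b) S" for b
    unfolding smooth_on_def g_def
    by (intro allI Ck_on_segment_integral[OF S]) (use f1 in simp)
  show "g b a = frechet_derivative f (at a) b" for b
    by (simp add: g_def)
  fix x assume x: "x \<in> S"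
  have seg: "a + t *\<^sub>R (x - a) \<in> S" if "t \<in> {0..1}" for t
  proof -
    have "(1 - t) *\<^sub>R a + t *\<^sub>R x \<in> S" using S x that by (intro convexD) auto
    then show ?thesis by (simp add: algebra_simps)
  qed
  have contd: "continuous_on S (\<lambda>x. frechet_derivative f (at x) v)" for v
    using f1[of 0] by simp
  let ?d = "\<lambda>t. frechet_derivative f (at (a + t *\<^sub>R (x - a)))"
  have der: "((\<lambda>t. f (a + t *\<^sub>R (x - a))) has_vector_derivative ?d t (x - a)) (at t within {0..1})"
    if "t \<in> {0..1}" for t
  proof -
    note h = Ck_on_SucD[OF f1 S(1) seg[OF that]]
    have "((\<lambda>t. f (a + t *\<^sub>R (x - a))) has_derivative (\<lambda>s. ?d t (s *\<^sub>R (x - a)))) (at t)"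
      by (rule has_derivative_compose[where f = "\<lambda>t. a + t *\<^sub>R (x - a)", OF _ h]) (auto intro!: derivative_eq_intros)
    then show ?thesis
      using linear_scale[OF has_derivative_linear[OF h]]
      by (simp add: has_vector_derivative_def has_derivative_at_withinI)
  qed
  have "((\<lambda>t. ?d t (x - a)) has_integral f (a + 1 *\<^sub>R (x - a)) - f (a + 0 *\<^sub>R (x - a))) {0..1}"
    by (rule fundamental_theorem_of_calculus[OF _ der]) auto
  then have "f x - f a = integral {0..1} (\<lambda>t. ?d t (x - a))"
    by (simp add: integral_unique)
  also have "\<dots> = integral {0..1} (\<lambda>t. \<Sum>b\<in>Basis. ((x - a) \<bullet> b) * ?d t b)"
  proof (rule integral_cong)
    fix t :: real assume "t \<in> {0..1}"
    then have lin: "linear (?d t)"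
      using has_derivative_linear[OF Ck_on_SucD[OF f1 S(1) seg]] by blast
    have "?d t (\<Sum>b\<in>Basis. ((x - a) \<bullet> b) *\<^sub>R b) = (\<Sum>b\<in>Basis. ((x - a) \<bullet> b) * ?d t b)"
      by (simp only: linear_sum[OF lin] linear_scale[OF lin] real_scaleR_def)
    then show "?d t (x - a) = (\<Sum>b\<in>Basis. ((x - a) \<bullet> b) * ?d t b)"
      by (simp only: euclidean_representation)
  qed
  also have "\<dots> = (\<Sum>b\<in>Basis. integral {0..1} (\<lambda>t. ((x - a) \<bullet> b) * ?d t b))"
  proof (rule integral_sum)
    show "(\<lambda>t. ((x - a) \<bullet> b) * ?d t b) integrable_on {0..1}" for b
      by (intro integrable_continuous_real continuous_intros continuous_on_compose2[OF contd])
        (use seg in auto)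
  qed auto
  also have "\<dots> = (\<Sum>b\<in>Basis. ((x - a) \<bullet> b) * g b x)"
    by (simp add: g_def)
  finally show "f x = f a + (\<Sum>b\<in>Basis. ((x - a) \<bullet> b) * g b x)" by simp
qed

lemma smooth_on_subset: "smooth_on f S \<Longrightarrow> T \<subseteq> S \<Longrightarrow> smooth_on f T"
  by (auto simp: smooth_on_def intro: Ck_on_subset)

lemma smooth_on_cong:
  assumes "open S" and "\<And>x. x \<in> S \<Longrightarrow> f x = g x" and "smooth_on f S"
  shows "smooth_on g S"
  using assms Ck_on_cong unfolding smooth_on_def by blast

lemma smooth_on_local:
  assumes "open S" and "\<And>x. x \<in> S \<Longrightarrow> \<exists>T. open T \<and> x \<in> T \<and> smooth_on f T"
  shows "smooth_on f S"
  using assms unfolding smooth_on_def by (metis Ck_on_local)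

lemma smooth_on_has_derivative:
  assumes "smooth_on f S" and "open S" and "x \<in> S"
  shows "(f has_derivative frechet_derivative f (at x)) (at x)"
  using assms Ck_on_SucD unfolding smooth_on_def by blast

lemma smooth_on_frechet_derivative:
  "smooth_on f S \<Longrightarrow> smooth_on (\<lambda>x. frechet_derivative f (at x) v) S"
  unfolding smooth_on_def using Ck_on.simps(2) by blast

lemma smooth_on_const: "open S \<Longrightarrow> smooth_on (\<lambda>x. c) S"
  by (simp add: smooth_on_def Ck_on_const)

lemma smooth_on_id: "open S \<Longrightarrow> smooth_on (\<lambda>x. x) S"
  by (simp add: smooth_on_def Ck_on_id)

lemma smooth_on_linear: "open S \<Longrightarrow> bounded_linear L \<Longrightarrow> smooth_on f S \<Longrightarrow> smooth_on (\<lambda>x. L (f x)) S"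
  by (simp add: smooth_on_def Ck_on_linear)

lemma smooth_on_add: "open S \<Longrightarrow> smooth_on f S \<Longrightarrow> smooth_on g S \<Longrightarrow> smooth_on (\<lambda>x. f x + g x) S"
  by (simp add: smooth_on_def Ck_on_add)

lemma smooth_on_bilinear:
  "open S \<Longrightarrow> bounded_bilinear m \<Longrightarrow> smooth_on f S \<Longrightarrow> smooth_on g S \<Longrightarrow> smooth_on (\<lambda>x. m (f x) (g x)) S"
  by (simp add: smooth_on_def Ck_on_bilinear)

lemma smooth_on_compose:
  fixes f :: "'d::euclidean_space \<Rightarrow> 'e::euclidean_space"
  assumes "open S" and "open T" and "f ` S \<subseteq> T" and "smooth_on g T" and "smooth_on f S"
  shows "smooth_on (\<lambda>x. g (f x)) S"
  using assms Ck_on_compose unfolding smooth_on_def by blast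

section \<open>Tangent vectors and vector fields\<close>

text \<open>One chart around \<open>q\<close> suffices here, while \<open>smooth_fun\<close> tests
  all of them; so the smoothness of a concretely given function can be checked in whichever chart is
  at hand.\<close>

definition smooth_at :: "('a, 'e::euclidean_space) chart set \<Rightarrow> ('a \<Rightarrow> 'b::real_normed_vector) \<Rightarrow> 'a \<Rightarrow> bool" where
  "smooth_at \<A> h q \<longleftrightarrow>
     (\<exists>(U, \<phi>)\<in>\<A>. \<exists>N. q \<in> U \<and> open N \<and> \<phi> q \<in> N \<and> N \<subseteq> \<phi> ` U \<and> smooth_on (h \<circ> inv_into U \<phi>) N)"

locale smooth_manifold =
  fixes \<A> :: "('a::{t2_space, second_countable_topology}, 'e::euclidean_space) chart set"
  assumes atlas: "smooth_atlas \<A>"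
begin

lemma chart:
  assumes "(U, \<phi>) \<in> \<A>"
  shows "open U" and "open (\<phi> ` U)" and "continuous_on U \<phi>"
    and "continuous_on (\<phi> ` U) (inv_into U \<phi>)" and "\<And>q. q \<in> U \<Longrightarrow> inv_into U \<phi> (\<phi> q) = q"
proof -
  have *: "open U \<and> open (\<phi> ` U) \<and> homeomorphism U (\<phi> ` U) \<phi> (inv_into U \<phi>)"
    using atlas assms unfolding smooth_atlas_def by blast
  then show "open U" and "open (\<phi> ` U)" by auto
  from * show "continuous_on U \<phi>" and "continuous_on (\<phi> ` U) (inv_into U \<phi>)"
    and "\<And>q. q \<in> U \<Longrightarrow> inv_into U \<phi> (\<phi> q) = q"
    unfolding homeomorphism_def by blast+
qed

lemma ex_chart: "\<exists>U \<phi>. (U, \<phi>) \<in> \<A> \<and> p \<in> U"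
proof -
  have "p \<in> (\<Union>(U, \<phi>)\<in>\<A>. U)" using atlas unfolding smooth_atlas_def by blast
  then show ?thesis by auto
qed

lemma chart_image_open:
  assumes "(U, \<phi>) \<in> \<A>" and "open W" and "W \<subseteq> U"
  shows "open (\<phi> ` W)"
proof -
  note c = chart[OF assms(1)]
  have "\<phi> ` W = \<phi> ` U \<inter> inv_into U \<phi> -` W"
    using assms(3) c(5) by (force simp: subset_eq)
  then show ?thesis
    using continuous_open_preimage[OF c(4) c(2) assms(2)] by simp
qed

lemma transition_smooth:
  assumes "(U, \<phi>) \<in> \<A>" and "(V, \<psi>) \<in> \<A>"
  shows "smooth_on (\<psi> \<circ> inv_into U \<phi>) (\<phi> ` (U \<inter> V))"
  using atlas assms unfolding smooth_atlas_def by blast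

text \<open>Near a point of any chart, the coordinate expression of \<open>h\<close> is its
  expression in the chart provided by \<open>smooth_at\<close>, composed with a transition map;
  compatibility of the atlas carries smoothness over.\<close>

lemma smooth_funI:
  assumes "\<And>q. smooth_at \<A> h q"
  shows "smooth_fun \<A> h"
  unfolding smooth_fun_def
proof clarify
  fix V \<psi> assume V: "(V, \<psi>) \<in> \<A>"
  show "smooth_on (h \<circ> inv_into V \<psi>) (\<psi> ` V)"
  proof (rule smooth_on_local[OF chart(2)[OF V]])
    fix y assume "y \<in> \<psi> ` V"
    then obtain q where q: "q \<in> V" "y = \<psi> q" by auto
    from assms[of q] obtain U \<phi> N where U: "(U, \<phi>) \<in> \<A>"
      and N: "q \<in> U" "open N" "\<phi> q \<in> N" "N \<subseteq> \<phi> ` U" "smooth_on (h \<circ> inv_into U \<phi>) N"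
      unfolding smooth_at_def by auto
    define \<tau> where "\<tau> = \<phi> \<circ> inv_into V \<psi>"
    define T where "T = \<psi> ` (V \<inter> U) \<inter> \<tau> -` N"
    have op: "open (\<psi> ` (V \<inter> U))"
      using chart_image_open[OF V, of "V \<inter> U"] chart(1)[OF V] chart(1)[OF U] by auto
    have sm: "smooth_on \<tau> (\<psi> ` (V \<inter> U))" unfolding \<tau>_def by (rule transition_smooth[OF V U])
    have ct: "continuous_on (\<psi> ` (V \<inter> U)) \<tau>"
      using sm unfolding smooth_on_def by (metis Ck_on.simps(1))
    have oT: "open T" unfolding T_def by (rule continuous_open_preimage[OF ct op N(2)])
    have yT: "y \<in> T" using q N chart(5)[OF V] by (auto simp: T_def \<tau>_def)
    have "smooth_on (\<lambda>y. (h \<circ> inv_into U \<phi>) (\<tau> y)) T"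
      by (rule smooth_on_compose[OF oT N(2) _ N(5) smooth_on_subset[OF sm]]) (auto simp: T_def)
    then have "smooth_on (h \<circ> inv_into V \<psi>) T"
      by (rule smooth_on_cong[OF oT, rotated])
        (auto simp: T_def \<tau>_def chart(5)[OF U] chart(5)[OF V])
    then show "\<exists>T. open T \<and> y \<in> T \<and> smooth_on (h \<circ> inv_into V \<psi>) T"
      using oT yT by blast
  qed
qed

lemma smooth_at_chart:
  assumes U: "(U, \<phi>) \<in> \<A>" and "q \<in> U" and "open N" and "\<phi> q \<in> N" and "smooth_on h N"
  shows "smooth_at \<A> (\<lambda>z. h (\<phi> z)) q"
proof -
  have op: "open (N \<inter> \<phi> ` U)" using assms(3) chart(2)[OF U] by auto
  have "smooth_on ((\<lambda>z. h (\<phi> z)) \<circ> inv_into U \<phi>) (N \<inter> \<phi> ` U)"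
    by (rule smooth_on_cong[OF op _ smooth_on_subset[OF assms(5)]])
      (auto simp: chart(5)[OF U])
  then show ?thesis unfolding smooth_at_def using assms op
    by (intro bexI[OF _ U]) (auto intro!: exI[of _ "N \<inter> \<phi> ` U"])
qed

lemma smooth_at_cong:
  assumes "\<forall>\<^sub>F z in nhds q. h z = g z" and "smooth_at \<A> h q"
  shows "smooth_at \<A> g q"
proof -
  obtain W where W: "open W" "q \<in> W" "\<And>z. z \<in> W \<Longrightarrow> h z = g z"
    using assms(1) unfolding eventually_nhds by blast
  obtain U \<phi> N where U: "(U, \<phi>) \<in> \<A>"
    and N: "q \<in> U" "open N" "\<phi> q \<in> N" "N \<subseteq> \<phi> ` U" "smooth_on (h \<circ> inv_into U \<phi>) N"
    using assms(2) unfolding smooth_at_def by auto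
  let ?N = "N \<inter> \<phi> ` (W \<inter> U)"
  have op: "open ?N"
    using N(2) chart_image_open[OF U, of "W \<inter> U"] W(1) chart(1)[OF U] by auto
  have "smooth_on (g \<circ> inv_into U \<phi>) ?N"
    by (rule smooth_on_cong[OF op _ smooth_on_subset[OF N(5)]]) (auto simp: chart(5)[OF U] W(3))
  moreover have "\<phi> q \<in> ?N" "?N \<subseteq> \<phi> ` U" using N W(2) by auto
  ultimately show ?thesis unfolding smooth_at_def using op N(1)
    by (intro bexI[OF _ U]) (auto intro!: exI[of _ ?N])
qed

section \<open>Smooth functions on the manifold: algebra, bump functions, extension\<close>

lemma smooth_fun_const: "smooth_fun \<A> (\<lambda>x. c)"
  unfolding smooth_fun_def o_def by (auto intro: smooth_on_const chart(2))

lemma smooth_fun_linear: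
  assumes "bounded_linear L" and "smooth_fun \<A> f"
  shows "smooth_fun \<A> (\<lambda>x. L (f x))"
  using assms(2) unfolding smooth_fun_def o_def
  by (auto intro!: smooth_on_linear[OF _ assms(1)] chart(2))

lemma smooth_fun_add:
  assumes "smooth_fun \<A> f" and "smooth_fun \<A> g"
  shows "smooth_fun \<A> (\<lambda>x. f x + g x)"
  using assms unfolding smooth_fun_def o_def by (auto intro!: smooth_on_add chart(2))

lemma smooth_fun_mult:
  fixes f g :: "'a \<Rightarrow> real"
  assumes "smooth_fun \<A> f" and "smooth_fun \<A> g"
  shows "smooth_fun \<A> (\<lambda>x. f x * g x)"
  using assms unfolding smooth_fun_def o_def
  by (auto intro!: smooth_on_bilinear[OF _ bounded_bilinear_mult] chart(2))

lemma smooth_fun_scale: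
  fixes f :: "'a \<Rightarrow> real"
  assumes "smooth_fun \<A> f"
  shows "smooth_fun \<A> (\<lambda>x. c * f x)"
  by (rule smooth_fun_linear[OF bounded_linear_mult_right assms])

lemma smooth_fun_sum:
  assumes "finite I" and "\<And>i. i \<in> I \<Longrightarrow> smooth_fun \<A> (f i)"
  shows "smooth_fun \<A> (\<lambda>x. \<Sum>i\<in>I. f i x)"
  using assms by (induction I rule: finite_induct) (auto intro: smooth_fun_const smooth_fun_add)

lemma smooth_fun_minus:
  assumes "smooth_fun \<A> f"
  shows "smooth_fun \<A> (\<lambda>x. - f x)"
  by (rule smooth_fun_linear[OF bounded_linear_minus[OF bounded_linear_ident] assms])

lemma smooth_fun_inner:
  assumes "smooth_fun \<A> f"
  shows "smooth_fun \<A> (\<lambda>x. f x \<bullet> b)"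
  by (rule smooth_fun_linear[OF bounded_linear_inner_left assms])

lemma smooth_at_const: "smooth_at \<A> (\<lambda>x. c) q"
proof -
  obtain U \<phi> where "(U, \<phi>) \<in> \<A>" "q \<in> U" using ex_chart by blast
  from smooth_at_chart[OF this open_UNIV UNIV_I smooth_on_const[OF open_UNIV]] show ?thesis .
qed

text \<open>At points of \<open>K\<close> both factors are smooth; off \<open>K\<close> the product
  vanishes on an open set, because \<open>K\<close> is closed. Hence \<open>h\<close> may be
  arbitrary outside \<open>K\<close>, for instance a coordinate expression that makes sense only on
  a chart.\<close>

lemma smooth_fun_cutoff:
  assumes "smooth_fun \<A> \<rho>" and "closed K" and "\<And>q. q \<notin> K \<Longrightarrow> \<rho> q = 0"
    and "\<And>q. q \<in> K \<Longrightarrow> smooth_at \<A> h q"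
  shows "smooth_fun \<A> (\<lambda>q. \<rho> q *\<^sub>R h q)"
proof (rule smooth_funI)
  fix q
  show "smooth_at \<A> (\<lambda>q. \<rho> q *\<^sub>R h q) q"
  proof (cases "q \<in> K")
    case True
    obtain U \<phi> N where U: "(U, \<phi>) \<in> \<A>"
      and N: "q \<in> U" "open N" "\<phi> q \<in> N" "N \<subseteq> \<phi> ` U" "smooth_on (h \<circ> inv_into U \<phi>) N"
      using assms(4)[OF True] unfolding smooth_at_def by auto
    have "smooth_on (\<rho> \<circ> inv_into U \<phi>) N"
      using assms(1) U N(4) smooth_on_subset unfolding smooth_fun_def by blast
    from smooth_on_bilinear[OF N(2) bounded_bilinear_scaleR this N(5)]
    have "smooth_on ((\<lambda>q. \<rho> q *\<^sub>R h q) \<circ> inv_into U \<phi>) N" by (simp add: o_def)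
    then show ?thesis unfolding smooth_at_def using N
      by (intro bexI[OF _ U]) (auto intro!: exI[of _ N])
  next
    case False
    have "\<forall>\<^sub>F z in nhds q. 0 = \<rho> z *\<^sub>R h z"
      unfolding eventually_nhds by (intro exI[of _ "- K"]) (use False assms in auto)
    then show ?thesis by (rule smooth_at_cong) (rule smooth_at_const)
  qed
qed

lemma ex_bump:
  assumes "open G" and "p \<in> G"
  obtains \<rho> :: "'a \<Rightarrow> real" and K where "smooth_fun \<A> \<rho>" "\<forall>\<^sub>F q in nhds p. \<rho> q = 1"
    "closed K" "K \<subseteq> G" "\<And>q. q \<notin> K \<Longrightarrow> \<rho> q = 0"
proof -
  obtain U \<phi> where U: "(U, \<phi>) \<in> \<A>" and p: "p \<in> U" using ex_chart by blast
  note c = chart[OF U]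
  have "open (\<phi> ` (U \<inter> G))" using chart_image_open[OF U] c(1) assms(1) by auto
  moreover have "\<phi> p \<in> \<phi> ` (U \<inter> G)" using p assms(2) by auto
  ultimately obtain r where r: "r > 0" "cball (\<phi> p) r \<subseteq> \<phi> ` (U \<inter> G)"
    using open_contains_cball by blast
  define K where "K = inv_into U \<phi> ` cball (\<phi> p) r"
  define \<rho> where "\<rho> q = (if q \<in> U then plateau (\<phi> p) r (\<phi> q) else 0)" for q
  have sub: "cball (\<phi> p) r \<subseteq> \<phi> ` U" using r(2) by auto
  have "compact K" unfolding K_def
    by (rule compact_continuous_image[OF continuous_on_subset[OF c(4) sub] compact_cball])
  \<comment> \<open>For the extension by zero, \<open>K\<close> has to be closed in the whole space
    and not just in the chart; compactness and the Hausdorff property give this.\<close>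
  then have K: "closed K" by (rule compact_imp_closed)
  have KU: "K \<subseteq> U \<inter> G" using r(2) c(5) unfolding K_def by force
  have off: "\<rho> q = 0" if "q \<notin> K" for q
  proof (cases "q \<in> U")
    case True
    then have "\<phi> q \<notin> cball (\<phi> p) r" using that c(5)[OF True] unfolding K_def by force
    then show ?thesis using plateau_eq_0[OF r(1), of "\<phi> q" "\<phi> p"]
      by (auto simp: \<rho>_def dist_norm norm_minus_commute)
  qed (simp add: \<rho>_def)
  have "smooth_fun \<A> \<rho>"
  proof (rule smooth_funI)
    fix q
    show "smooth_at \<A> \<rho> q"
    proof (cases "q \<in> U")
      case True
      have ev: "\<forall>\<^sub>F z in nhds q. plateau (\<phi> p) r (\<phi> z) = \<rho> z"
        unfolding eventually_nhds by (intro exI[of _ U]) (use True c(1) in \<open>auto simp: \<rho>_def\<close>)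
      show ?thesis
        by (rule smooth_at_cong[OF ev smooth_at_chart[OF U True open_UNIV UNIV_I smooth_on_plateau[OF r(1)]]])
    next
      case False
      have "\<forall>\<^sub>F z in nhds q. 0 = \<rho> z"
        unfolding eventually_nhds by (intro exI[of _ "- K"]) (use False KU K off in auto)
      then show ?thesis by (rule smooth_at_cong) (rule smooth_at_const)
    qed
  qed
  moreover have "\<forall>\<^sub>F q in nhds p. \<rho> q = 1"
    unfolding eventually_nhds
  proof (intro exI[of _ "U \<inter> \<phi> -` ball (\<phi> p) (r / 2)"] conjI ballI)
    show "open (U \<inter> \<phi> -` ball (\<phi> p) (r / 2))"
      by (rule continuous_open_preimage[OF c(3) c(1) open_ball])
    show "p \<in> U \<inter> \<phi> -` ball (\<phi> p) (r / 2)" using p r(1) by auto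
    fix q assume "q \<in> U \<inter> \<phi> -` ball (\<phi> p) (r / 2)"
    then show "\<rho> q = 1"
      using plateau_eq_1[OF r(1), of "\<phi> q" "\<phi> p"] by (auto simp: \<rho>_def dist_norm norm_minus_commute)
  qed
  ultimately show thesis using that K KU off by blast
qed

text \<open>Derivations are governed by their values on globally smooth functions, so a function
  given only near \<open>p\<close> enters through a global one with the same germ.\<close>

lemma ex_extension:
  assumes "open G" and "p \<in> G" and "\<And>q. q \<in> G \<Longrightarrow> smooth_at \<A> h q"
  shows "\<exists>F. smooth_fun \<A> F \<and> (\<forall>\<^sub>F q in nhds p. F q = h q)"
proof -
  obtain \<rho> :: "'a \<Rightarrow> real" and K where \<rho>: "smooth_fun \<A> \<rho>" "\<forall>\<^sub>F q in nhds p. \<rho> q = 1"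
    "closed K" "K \<subseteq> G" "\<And>q. q \<notin> K \<Longrightarrow> \<rho> q = 0"
    using ex_bump[OF assms(1,2)] by blast
  have "smooth_fun \<A> (\<lambda>q. \<rho> q *\<^sub>R h q)"
    by (rule smooth_fun_cutoff[OF \<rho>(1,3,5)]) (use \<rho>(4) assms(3) in auto)
  moreover have "\<forall>\<^sub>F q in nhds p. \<rho> q *\<^sub>R h q = h q"
    using \<rho>(2) by eventually_elim simp
  ultimately show ?thesis by blast
qed

section \<open>Tangent vectors in coordinates\<close>

lemma tangent_add: "v \<in> tangent_space \<A> p \<Longrightarrow> smooth_fun \<A> f \<Longrightarrow> smooth_fun \<A> g \<Longrightarrow>
    v (\<lambda>x. f x + g x) = v f + v g"
  and tangent_scale: "v \<in> tangent_space \<A> p \<Longrightarrow> smooth_fun \<A> f \<Longrightarrow> v (\<lambda>x. c * f x) = c * v f"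
  and tangent_mult: "v \<in> tangent_space \<A> p \<Longrightarrow> smooth_fun \<A> f \<Longrightarrow> smooth_fun \<A> g \<Longrightarrow>
    v (\<lambda>x. f x * g x) = f p * v g + g p * v f"
  and tangent_not_smooth: "v \<in> tangent_space \<A> p \<Longrightarrow> \<not> smooth_fun \<A> f \<Longrightarrow> v f = 0"
  by (simp_all add: tangent_space_def)

lemma tangent_const:
  assumes "v \<in> tangent_space \<A> p"
  shows "v (\<lambda>x. c) = 0"
proof -
  have "v (\<lambda>x. 1 * 1) = 1 * v (\<lambda>x. 1) + 1 * v (\<lambda>x. 1)"
    by (rule tangent_mult[OF assms smooth_fun_const smooth_fun_const])
  then have "v (\<lambda>x. 1) = 0" by simp
  then show ?thesis using tangent_scale[OF assms smooth_fun_const, of c 1] by simp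
qed

lemma tangent_sum:
  assumes "v \<in> tangent_space \<A> p" and "finite I" and "\<And>i. i \<in> I \<Longrightarrow> smooth_fun \<A> (f i)"
  shows "v (\<lambda>x. \<Sum>i\<in>I. f i x) = (\<Sum>i\<in>I. v (f i))"
  using assms(2,3)
proof (induction I rule: finite_induct)
  case empty
  then show ?case using tangent_const[OF assms(1)] by simp
next
  case (insert i I)
  then show ?case using tangent_add[OF assms(1), of "f i" "\<lambda>x. \<Sum>i\<in>I. f i x"]
    by (simp add: smooth_fun_sum)
qed

text \<open>For a bump function \<open>\<rho>\<close> supported where \<open>f\<close> and
  \<open>g\<close> agree, \<open>\<rho> q * f q = \<rho> q * g q\<close> holds at every
  \<open>q\<close>; the Leibniz rule and \<open>\<rho> p = 1\<close> then remove
  \<open>\<rho>\<close>. So a derivation sees only germs.\<close>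

lemma tangent_cong:
  assumes v: "v \<in> tangent_space \<A> p" and f: "smooth_fun \<A> f" and g: "smooth_fun \<A> g"
    and "\<forall>\<^sub>F q in nhds p. f q = g q"
  shows "v f = v g"
proof -
  obtain G where G: "open G" "p \<in> G" "\<And>z. z \<in> G \<Longrightarrow> f z = g z"
    using assms(4) unfolding eventually_nhds by blast
  obtain \<rho> :: "'a \<Rightarrow> real" and K where \<rho>: "smooth_fun \<A> \<rho>" "\<forall>\<^sub>F q in nhds p. \<rho> q = 1"
    "closed K" "K \<subseteq> G" "\<And>q. q \<notin> K \<Longrightarrow> \<rho> q = 0"
    using ex_bump[OF G(1,2)] by blast
  have 1: "\<rho> p = 1" using \<rho>(2) by (rule eventually_nhds_x_imp_x)
  have "(\<lambda>q. \<rho> q * f q) = (\<lambda>q. \<rho> q * g q)"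
    using G(3) \<rho>(4,5) by (auto simp: fun_eq_iff)
  then have "\<rho> p * v f + f p * v \<rho> = \<rho> p * v g + g p * v \<rho>"
    using tangent_mult[OF v \<rho>(1) f] tangent_mult[OF v \<rho>(1) g] by simp
  then show ?thesis using 1 G(2,3) by simp
qed

text \<open>Hadamard's lemma writes \<open>f\<close> near \<open>q\<close> as a constant plus
  products of a shifted coordinate, which vanishes at \<open>q\<close>, with a smooth factor. In the
  Leibniz rule only the value of that factor at \<open>q\<close> survives, and this is the partial
  derivative. The functions \<open>x\<close> and \<open>F b\<close> are global stand-ins for the
  chart and for the Hadamard factors.\<close>

lemma tangent_chart_expansion:
  assumes U: "(U, \<phi>) \<in> \<A>" and q: "q \<in> U" and v: "v \<in> tangent_space \<A> q"
    and x: "smooth_fun \<A> x" "\<forall>\<^sub>F z in nhds q. x z = \<phi> z" and f: "smooth_fun \<A> f"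
  shows "v f = (\<Sum>b\<in>Basis. v (\<lambda>z. x z \<bullet> b) * frechet_derivative (f \<circ> inv_into U \<phi>) (at (\<phi> q)) b)"
proof -
  note c = chart[OF U]
  obtain r where r: "r > 0" "ball (\<phi> q) r \<subseteq> \<phi> ` U"
    using c(2) q open_contains_ball by blast
  let ?B = "ball (\<phi> q) r"
  have sm: "smooth_on (f \<circ> inv_into U \<phi>) ?B"
    using f U r(2) smooth_on_subset unfolding smooth_fun_def by blast
  obtain g where g: "\<And>b. smooth_on (g b) ?B"
    and gexp: "\<And>y. y \<in> ?B \<Longrightarrow> (f \<circ> inv_into U \<phi>) y =
      (f \<circ> inv_into U \<phi>) (\<phi> q) + (\<Sum>b\<in>Basis. ((y - \<phi> q) \<bullet> b) * g b y)"
    and gq: "\<And>b. g b (\<phi> q) = frechet_derivative (f \<circ> inv_into U \<phi>) (at (\<phi> q)) b"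
    using smooth_on_hadamard[OF open_ball convex_ball _ sm, of "\<phi> q"] r(1) by auto
  let ?G = "U \<inter> \<phi> -` ?B"
  have G: "open ?G" by (rule continuous_open_preimage[OF c(3) c(1) open_ball])
  have qG: "q \<in> ?G" using q r(1) by auto
  have "\<exists>F. smooth_fun \<A> F \<and> (\<forall>\<^sub>F z in nhds q. F z = g b (\<phi> z))" for b
    by (rule ex_extension[OF G qG]) (auto intro!: smooth_at_chart[OF U _ open_ball _ g])
  then obtain F where F: "\<And>b. smooth_fun \<A> (F b)" "\<And>b. \<forall>\<^sub>F z in nhds q. F b z = g b (\<phi> z)"
    by metis
  have Fq: "F b q = frechet_derivative (f \<circ> inv_into U \<phi>) (at (\<phi> q)) b" for b
    using eventually_nhds_x_imp_x[OF F(2)[of b]] gq by simp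
  have xq: "x q = \<phi> q" by (rule eventually_nhds_x_imp_x[OF x(2)])
  define k where "k b z = x z \<bullet> b + - (\<phi> q \<bullet> b)" for b z
  have k: "smooth_fun \<A> (k b)" for b
    unfolding k_def by (intro smooth_fun_add smooth_fun_const smooth_fun_inner x(1))
  have vk: "v (k b) = v (\<lambda>z. x z \<bullet> b)" for b
  proof -
    have "v (k b) = v (\<lambda>z. x z \<bullet> b) + v (\<lambda>z. - (\<phi> q \<bullet> b))"
      unfolding k_def by (rule tangent_add[OF v smooth_fun_inner[OF x(1)] smooth_fun_const])
    then show ?thesis using tangent_const[OF v] by simp
  qed
  have kF: "smooth_fun \<A> (\<lambda>z. k b z * F b z)" for b by (intro smooth_fun_mult k F)
  have sF: "smooth_fun \<A> (\<lambda>z. \<Sum>b\<in>Basis. k b z * F b z)"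
    by (intro smooth_fun_sum kF) auto
  have "\<forall>\<^sub>F z in nhds q. \<forall>b\<in>Basis. F b z = g b (\<phi> z)"
    by (rule eventually_ball_finite) (use F(2) in auto)
  moreover have "\<forall>\<^sub>F z in nhds q. z \<in> ?G"
    using G qG by (rule eventually_nhds_in_open)
  ultimately have "\<forall>\<^sub>F z in nhds q. f z = f q + (\<Sum>b\<in>Basis. k b z * F b z)"
    using x(2)
  proof eventually_elim
    case (elim z)
    then have "f z = f q + (\<Sum>b\<in>Basis. ((\<phi> z - \<phi> q) \<bullet> b) * g b (\<phi> z))"
      using gexp[of "\<phi> z"] q c(5) by auto
    with elim show ?case by (simp add: k_def inner_diff_left)
  qed
  then have "v f = v (\<lambda>z. f q + (\<Sum>b\<in>Basis. k b z * F b z))"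
    by (intro tangent_cong[OF v f] smooth_fun_add smooth_fun_const sF)
  also have "\<dots> = (\<Sum>b\<in>Basis. v (\<lambda>z. k b z * F b z))"
    using tangent_add[OF v smooth_fun_const sF] tangent_const[OF v]
      tangent_sum[OF v finite_Basis kF] by simp
  also have "\<dots> = (\<Sum>b\<in>Basis. v (\<lambda>z. x z \<bullet> b) * frechet_derivative (f \<circ> inv_into U \<phi>) (at (\<phi> q)) b)"
  proof (rule sum.cong[OF refl])
    fix b :: 'e
    have "v (\<lambda>z. k b z * F b z) = k b q * v (F b) + F b q * v (k b)"
      by (rule tangent_mult[OF v k F(1)])
    moreover have "k b q = 0" by (simp add: k_def xq)
    ultimately show "v (\<lambda>z. k b z * F b z) =
        v (\<lambda>z. x z \<bullet> b) * frechet_derivative (f \<circ> inv_into U \<phi>) (at (\<phi> q)) b"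
      by (simp add: Fq vk)
  qed
  finally show ?thesis .
qed

text \<open>This is the partial derivative in direction \<open>b\<close>, cut off so as to live on
  the whole space. The value 0 on functions that are not smooth is the one that
  \<open>tangent_space\<close> prescribes.\<close>

lemma vector_field_coordinate:
  assumes U: "(U, \<phi>) \<in> \<A>" and \<rho>: "smooth_fun \<A> \<rho>" "closed K" "K \<subseteq> U" "\<And>q. q \<notin> K \<Longrightarrow> \<rho> q = 0"
  shows "vector_field \<A> (\<lambda>q f. if smooth_fun \<A> f
    then \<rho> q * frechet_derivative (f \<circ> inv_into U \<phi>) (at (\<phi> q)) b else 0)"
  unfolding vector_field_def
proof (intro conjI allI impI)
  note c = chart[OF U]
  fix q
  show "(\<lambda>f. if smooth_fun \<A> f
    then \<rho> q * frechet_derivative (f \<circ> inv_into U \<phi>) (at (\<phi> q)) b else 0) \<in> tangent_space \<A> q"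
  proof (cases "q \<in> K")
    case False
    then show ?thesis using \<rho>(4) by (auto simp: tangent_space_def)
  next
    case True
    then have q: "q \<in> U" using \<rho>(3) by auto
    let ?c = "\<lambda>f y. f (inv_into U \<phi> y)"
    let ?D = "\<lambda>f. frechet_derivative (?c f) (at (\<phi> q))"
    have D: "(?c f has_derivative ?D f) (at (\<phi> q))" if "smooth_fun \<A> f" for f :: "'a \<Rightarrow> real"
      using smooth_on_has_derivative[of "f \<circ> inv_into U \<phi>" "\<phi> ` U" "\<phi> q"] that U c(2) q
      by (auto simp: smooth_fun_def o_def)
    have "?D (\<lambda>x. f x + g x) = (\<lambda>v. ?D f v + ?D g v)"
      if "smooth_fun \<A> f" "smooth_fun \<A> g" for f g :: "'a \<Rightarrow> real"
      by (rule frechet_derivative_at[OF has_derivative_add[OF D[OF that(1)] D[OF that(2)]], symmetric])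
    moreover have "?D (\<lambda>x. a * f x) = (\<lambda>v. a * ?D f v)"
      if "smooth_fun \<A> f" for f :: "'a \<Rightarrow> real" and a
      by (rule frechet_derivative_at[OF has_derivative_mult_right[OF D[OF that]], symmetric])
    moreover have "?D (\<lambda>x. f x * g x) = (\<lambda>v. ?c f (\<phi> q) * ?D g v + ?D f v * ?c g (\<phi> q))"
      if "smooth_fun \<A> f" "smooth_fun \<A> g" for f g :: "'a \<Rightarrow> real"
      by (rule frechet_derivative_at[OF has_derivative_mult[OF D[OF that(1)] D[OF that(2)]], symmetric])
    ultimately show ?thesis
      by (simp add: tangent_space_def o_def smooth_fun_add smooth_fun_mult smooth_fun_scale c(5)[OF q] algebra_simps)
  qed
next
  note c = chart[OF U]
  fix f :: "'a \<Rightarrow> real" assume f: "smooth_fun \<A> f"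
  have "smooth_on (\<lambda>y. frechet_derivative (f \<circ> inv_into U \<phi>) (at y) b) (\<phi> ` U)"
    using f U unfolding smooth_fun_def by (blast intro: smooth_on_frechet_derivative)
  then have "smooth_at \<A> (\<lambda>q. frechet_derivative (f \<circ> inv_into U \<phi>) (at (\<phi> q)) b) q" if "q \<in> U" for q
    by (rule smooth_at_chart[OF U that c(2) imageI[OF that]])
  then have "smooth_fun \<A> (\<lambda>q. \<rho> q *\<^sub>R frechet_derivative (f \<circ> inv_into U \<phi>) (at (\<phi> q)) b)"
    by (intro smooth_fun_cutoff[OF \<rho>(1,2,4)]) (use \<rho>(3) in auto)
  then show "smooth_fun \<A> (\<lambda>q. if smooth_fun \<A> f
    then \<rho> q * frechet_derivative (f \<circ> inv_into U \<phi>) (at (\<phi> q)) b else 0)"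
    using f by simp
qed

text \<open>The coefficients are values of \<open>v\<close> on the globally smooth functions
  \<open>x z \<bullet> b\<close>, so for a vector field they depend smoothly on the point. On
  \<open>W\<close> the cutoff is 1 and \<open>x\<close> coincides with the chart; the expansion is
  wanted on an open set, not merely at \<open>p\<close>, because \<open>ext_deriv\<close>
  differentiates.\<close>

lemma ex_local_frame:
  obtains E :: "'e \<Rightarrow> 'a vfield" and x :: "'a \<Rightarrow> 'e" and W where "open W" "p \<in> W"
    "\<And>b. vector_field \<A> (E b)" "smooth_fun \<A> x"
    "\<And>q v. q \<in> W \<Longrightarrow> v \<in> tangent_space \<A> q \<Longrightarrow> v = (\<lambda>f. \<Sum>b\<in>Basis. v (\<lambda>z. x z \<bullet> b) * E b q f)"
proof -
  obtain U \<phi> where U: "(U, \<phi>) \<in> \<A>" and p: "p \<in> U" using ex_chart by blast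
  note c = chart[OF U]
  obtain \<rho> :: "'a \<Rightarrow> real" and K where \<rho>: "smooth_fun \<A> \<rho>" "\<forall>\<^sub>F q in nhds p. \<rho> q = 1"
    "closed K" "K \<subseteq> U" "\<And>q. q \<notin> K \<Longrightarrow> \<rho> q = 0"
    using ex_bump[OF c(1) p] by blast
  have "\<exists>F. smooth_fun \<A> F \<and> (\<forall>\<^sub>F z in nhds p. F z = \<phi> z)"
    by (rule ex_extension[OF c(1) p]) (rule smooth_at_chart[OF U _ open_UNIV UNIV_I smooth_on_id[OF open_UNIV]])
  then obtain x where x: "smooth_fun \<A> x" "\<forall>\<^sub>F z in nhds p. x z = \<phi> z" by blast
  have "\<forall>\<^sub>F z in nhds p. x z = \<phi> z \<and> \<rho> z = 1 \<and> z \<in> U"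
    using x(2) \<rho>(2) eventually_nhds_in_open[OF c(1) p] by eventually_elim simp
  then obtain W where W: "open W" "p \<in> W" "\<And>z. z \<in> W \<Longrightarrow> x z = \<phi> z \<and> \<rho> z = 1 \<and> z \<in> U"
    unfolding eventually_nhds by blast
  define E where "E b q f = (if smooth_fun \<A> f
    then \<rho> q * frechet_derivative (f \<circ> inv_into U \<phi>) (at (\<phi> q)) b else 0)" for b q f
  show thesis
  proof (rule that[OF W(1,2)])
    show "vector_field \<A> (E b)" for b
      unfolding E_def by (rule vector_field_coordinate[OF U \<rho>(1,3,4,5)])
    show "smooth_fun \<A> x" by (rule x)
    fix q v assume q: "q \<in> W" and v: "v \<in> tangent_space \<A> q"
    have ev: "\<forall>\<^sub>F z in nhds q. x z = \<phi> z"
      using W q unfolding eventually_nhds by blast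
    show "v = (\<lambda>f. \<Sum>b\<in>Basis. v (\<lambda>z. x z \<bullet> b) * E b q f)"
    proof
      fix f
      show "v f = (\<Sum>b\<in>Basis. v (\<lambda>z. x z \<bullet> b) * E b q f)"
      proof (cases "smooth_fun \<A> f")
        case True
        then show ?thesis
          using tangent_chart_expansion[OF U _ v x(1) ev True] W(3)[OF q] by (simp add: E_def)
      next
        case False
        then show ?thesis using tangent_not_smooth[OF v False] by (simp add: E_def)
      qed
    qed
  qed
qed

section \<open>Combinations and brackets of vector fields\<close>

lemma tangent_combination:
  assumes "finite I" and "\<And>i. i \<in> I \<Longrightarrow> v i \<in> tangent_space \<A> p"
  shows "(\<lambda>f. \<Sum>i\<in>I. c i * v i f) \<in> tangent_space \<A> p"
  unfolding tangent_space_def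
proof (intro CollectI conjI allI impI)
  fix f g :: "'a \<Rightarrow> real" and a :: real
  show "(\<Sum>i\<in>I. c i * v i (\<lambda>x. f x + g x)) = (\<Sum>i\<in>I. c i * v i f) + (\<Sum>i\<in>I. c i * v i g)"
    if "smooth_fun \<A> f" "smooth_fun \<A> g"
    unfolding sum.distrib[symmetric]
    by (rule sum.cong[OF refl]) (simp add: tangent_add[OF assms(2) that] distrib_left)
  show "(\<Sum>i\<in>I. c i * v i (\<lambda>x. a * f x)) = a * (\<Sum>i\<in>I. c i * v i f)" if "smooth_fun \<A> f"
    unfolding sum_distrib_left
    by (rule sum.cong[OF refl]) (simp add: tangent_scale[OF assms(2) that])
  show "(\<Sum>i\<in>I. c i * v i (\<lambda>x. f x * g x)) = f p * (\<Sum>i\<in>I. c i * v i g) + g p * (\<Sum>i\<in>I. c i * v i f)"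
    if "smooth_fun \<A> f" "smooth_fun \<A> g"
    unfolding sum_distrib_left sum.distrib[symmetric]
    by (rule sum.cong[OF refl]) (simp add: tangent_mult[OF assms(2) that] distrib_left)
  show "(\<Sum>i\<in>I. c i * v i f) = 0" if "\<not> smooth_fun \<A> f"
    by (rule sum.neutral) (simp add: tangent_not_smooth[OF assms(2) that])
qed

lemma vector_field_tangent: "vector_field \<A> X \<Longrightarrow> X p \<in> tangent_space \<A> p"
  and vector_field_smooth: "vector_field \<A> X \<Longrightarrow> smooth_fun \<A> f \<Longrightarrow> smooth_fun \<A> (\<lambda>p. X p f)"
  by (auto simp: vector_field_def)

lemma vector_field_combination:
  assumes "finite I" and "\<And>i. i \<in> I \<Longrightarrow> vector_field \<A> (X i)" and "\<And>i. i \<in> I \<Longrightarrow> smooth_fun \<A> (g i)"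
  shows "vector_field \<A> (\<lambda>q f. \<Sum>i\<in>I. g i q * X i q f)"
  unfolding vector_field_def
proof (intro conjI allI impI)
  show "(\<lambda>f. \<Sum>i\<in>I. g i p * X i p f) \<in> tangent_space \<A> p" for p
    by (rule tangent_combination[OF assms(1) vector_field_tangent[OF assms(2)]])
  show "smooth_fun \<A> (\<lambda>p. \<Sum>i\<in>I. g i p * X i p f)" if "smooth_fun \<A> f" for f
    by (rule smooth_fun_sum[OF assms(1) smooth_fun_mult[OF assms(3) vector_field_smooth[OF assms(2) that]]])
qed

lemma lie_bracket_tangent:
  assumes X: "vector_field \<A> X" and Y: "vector_field \<A> Y"
  shows "lie_bracket X Y p \<in> tangent_space \<A> p"
proof -
  note XT = vector_field_tangent[OF X] and YT = vector_field_tangent[OF Y]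
  \<comment> \<open>The cross terms \<open>W p g * V p f\<close> and \<open>W p f * V p g\<close>
    are exchanged when \<open>V\<close> and \<open>W\<close> are swapped, so they cancel in the
    commutator.\<close>
  have m: "V p (\<lambda>q. W q (\<lambda>x. f x * g x)) =
      f p * V p (\<lambda>q. W q g) + W p g * V p f + g p * V p (\<lambda>q. W q f) + W p f * V p g"
    if V: "vector_field \<A> V" and W: "vector_field \<A> W" and f: "smooth_fun \<A> f" and g: "smooth_fun \<A> g"
    for V W :: "'a vfield" and f g
  proof -
    note VT = vector_field_tangent[OF V]
    have s: "smooth_fun \<A> (\<lambda>q. f q * W q g)" "smooth_fun \<A> (\<lambda>q. g q * W q f)"
      by (rule smooth_fun_mult[OF f vector_field_smooth[OF W g]],
        rule smooth_fun_mult[OF g vector_field_smooth[OF W f]])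
    have "(\<lambda>q. W q (\<lambda>x. f x * g x)) = (\<lambda>q. f q * W q g + g q * W q f)"
      by (rule ext) (rule tangent_mult[OF vector_field_tangent[OF W] f g])
    then show ?thesis
      using tangent_add[OF VT s] tangent_mult[OF VT f vector_field_smooth[OF W g]]
        tangent_mult[OF VT g vector_field_smooth[OF W f]] by (simp add: algebra_simps)
  qed
  show ?thesis
    unfolding tangent_space_def lie_bracket_def
  proof (intro CollectI conjI allI impI)
    fix f g :: "'a \<Rightarrow> real" and c :: real
    assume f: "smooth_fun \<A> f"
    note Xf = vector_field_smooth[OF X f] and Yf = vector_field_smooth[OF Y f]
    show "X p (\<lambda>q. Y q (\<lambda>x. c * f x)) - Y p (\<lambda>q. X q (\<lambda>x. c * f x)) =
        c * (X p (\<lambda>q. Y q f) - Y p (\<lambda>q. X q f))"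
      by (simp add: tangent_scale[OF XT f] tangent_scale[OF YT f]
          tangent_scale[OF XT Yf] tangent_scale[OF YT Xf] algebra_simps)
    assume g: "smooth_fun \<A> g"
    note Xg = vector_field_smooth[OF X g] and Yg = vector_field_smooth[OF Y g]
    show "X p (\<lambda>q. Y q (\<lambda>x. f x + g x)) - Y p (\<lambda>q. X q (\<lambda>x. f x + g x)) =
        X p (\<lambda>q. Y q f) - Y p (\<lambda>q. X q f) + (X p (\<lambda>q. Y q g) - Y p (\<lambda>q. X q g))"
      by (simp add: tangent_add[OF XT f g] tangent_add[OF YT f g]
          tangent_add[OF XT Yf Yg] tangent_add[OF YT Xf Xg])
    show "X p (\<lambda>q. Y q (\<lambda>x. f x * g x)) - Y p (\<lambda>q. X q (\<lambda>x. f x * g x)) =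
        f p * (X p (\<lambda>q. Y q g) - Y p (\<lambda>q. X q g)) + g p * (X p (\<lambda>q. Y q f) - Y p (\<lambda>q. X q f))"
      by (simp add: m[OF X Y f g] m[OF Y X f g] algebra_simps)
  next
    fix f :: "'a \<Rightarrow> real" assume "\<not> smooth_fun \<A> f"
    then show "X p (\<lambda>q. Y q f) - Y p (\<lambda>q. X q f) = 0"
      by (simp add: tangent_not_smooth[OF XT] tangent_not_smooth[OF YT] tangent_const[OF XT] tangent_const[OF YT])
  qed
qed

end

section \<open>One-forms and their exterior derivative\<close>

locale manifold_one_form = smooth_manifold \<A>
  for \<A> :: "('a::{t2_space, second_countable_topology}, 'e::euclidean_space) chart set" +
  fixes \<alpha> :: "'a form1"
  assumes one_form: "one_form \<A> \<alpha>"
begin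

lemma form_linear:
  "u \<in> tangent_space \<A> p \<Longrightarrow> v \<in> tangent_space \<A> p \<Longrightarrow>
    \<alpha> p (\<lambda>f. a * u f + b * v f) = a * \<alpha> p u + b * \<alpha> p v"
  using one_form by (simp add: one_form_def)

lemma form_smooth: "vector_field \<A> X \<Longrightarrow> smooth_fun \<A> (\<lambda>p. \<alpha> p (X p))"
  using one_form by (simp add: one_form_def)

lemma form_zero: "\<alpha> p (\<lambda>f. 0) = 0"
  using form_linear[of "\<lambda>f. 0" p "\<lambda>f. 0" 0 0] by (simp add: tangent_space_def)

lemma form_combination:
  assumes "finite I" and "\<And>i. i \<in> I \<Longrightarrow> v i \<in> tangent_space \<A> p"
  shows "\<alpha> p (\<lambda>f. \<Sum>i\<in>I. c i * v i f) = (\<Sum>i\<in>I. c i * \<alpha> p (v i))"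
  using assms
proof (induction I rule: finite_induct)
  case empty
  then show ?case by (simp add: form_zero)
next
  case (insert i I)
  then show ?case
    using form_linear[of "v i" p "\<lambda>f. \<Sum>i\<in>I. c i * v i f" "c i" 1] tangent_combination[of I v p c]
    by simp
qed

lemma ext_deriv_skew:
  assumes X: "vector_field \<A> X" and Y: "vector_field \<A> Y"
  shows "ext_deriv \<alpha> X Y p = - ext_deriv \<alpha> Y X p"
proof -
  have "lie_bracket Y X p = (\<lambda>f. (-1) * lie_bracket X Y p f + 0 * lie_bracket X Y p f)"
    by (simp add: lie_bracket_def)
  then show ?thesis
    using form_linear[OF lie_bracket_tangent[OF X Y] lie_bracket_tangent[OF X Y], where a = "- 1" and b = 0]
    by (simp add: ext_deriv_def)
qed

text \<open>Derivatives of the coefficients appear twice: as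
  \<open>\<alpha> p (X i p) * Y p (g i)\<close> in the derivative along \<open>Y\<close>, and with
  the opposite sign in the bracket term. They cancel, which is why d\<alpha> is linear over smooth
  functions.\<close>

lemma ext_deriv_combination:
  assumes I: "finite I" and X: "\<And>i. i \<in> I \<Longrightarrow> vector_field \<A> (X i)"
    and g: "\<And>i. i \<in> I \<Longrightarrow> smooth_fun \<A> (g i)" and Y: "vector_field \<A> Y"
  shows "ext_deriv \<alpha> (\<lambda>q f. \<Sum>i\<in>I. g i q * X i q f) Y p = (\<Sum>i\<in>I. g i p * ext_deriv \<alpha> (X i) Y p)"
proof -
  note XT = vector_field_tangent[OF X] and YT = vector_field_tangent[OF Y]
  let ?X = "\<lambda>q f. \<Sum>i\<in>I. g i q * X i q f"
  have leibniz: "Y p (\<lambda>q. \<Sum>i\<in>I. g i q * h i q) = (\<Sum>i\<in>I. g i p * Y p (h i) + h i p * Y p (g i))"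
    if "\<And>i. i \<in> I \<Longrightarrow> smooth_fun \<A> (h i)" for h
  proof -
    have "Y p (\<lambda>q. \<Sum>i\<in>I. g i q * h i q) = (\<Sum>i\<in>I. Y p (\<lambda>q. g i q * h i q))"
      by (rule tangent_sum[OF YT I]) (use that g in \<open>auto intro: smooth_fun_mult\<close>)
    also have "\<dots> = (\<Sum>i\<in>I. g i p * Y p (h i) + h i p * Y p (g i))"
      by (rule sum.cong[OF refl]) (use that g in \<open>auto intro: tangent_mult[OF YT]\<close>)
    finally show ?thesis .
  qed
  have "(\<lambda>q. \<alpha> q (?X q)) = (\<lambda>q. \<Sum>i\<in>I. g i q * \<alpha> q (X i q))"
    by (rule ext) (rule form_combination[OF I XT])
  then have t2: "Y p (\<lambda>q. \<alpha> q (?X q)) =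
      (\<Sum>i\<in>I. g i p * Y p (\<lambda>q. \<alpha> q (X i q)) + \<alpha> p (X i p) * Y p (g i))"
    using leibniz[of "\<lambda>i q. \<alpha> q (X i q)"] form_smooth X by simp
  have "lie_bracket ?X Y p f =
     1 * (\<Sum>i\<in>I. g i p * lie_bracket (X i) Y p f) + (-1) * (\<Sum>i\<in>I. Y p (g i) * X i p f)" for f
  proof -
    have "Y p (\<lambda>q. \<Sum>i\<in>I. g i q * X i q f) = (\<Sum>i\<in>I. g i p * Y p (\<lambda>q. X i q f) + X i p f * Y p (g i))"
    proof (cases "smooth_fun \<A> f")
      case True
      then show ?thesis
        using leibniz[of "\<lambda>i q. X i q f"] vector_field_smooth X by simp
    next
      \<comment> \<open>Every \<open>X i\<close> is 0 on a function that is not smooth, so both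
        sides vanish.\<close>
      case False
      then have "X i q f = 0" if "i \<in> I" for i q
        using tangent_not_smooth[OF XT[OF that]] by blast
      then show ?thesis using tangent_const[OF YT] by simp
    qed
    then show ?thesis
      by (simp add: lie_bracket_def sum.distrib sum_subtractf right_diff_distrib mult.commute)
  qed
  then have "\<alpha> p (lie_bracket ?X Y p) = \<alpha> p (\<lambda>f. 1 * (\<Sum>i\<in>I. g i p * lie_bracket (X i) Y p f) +
      (-1) * (\<Sum>i\<in>I. Y p (g i) * X i p f))"
    by presburger
  also have "\<dots> = 1 * (\<Sum>i\<in>I. g i p * \<alpha> p (lie_bracket (X i) Y p)) + (-1) * (\<Sum>i\<in>I. Y p (g i) * \<alpha> p (X i p))"
    using I X Y XT lie_bracket_tangent
    by (subst form_linear) (auto intro!: tangent_combination simp: form_combination)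
  finally show ?thesis
    by (simp add: ext_deriv_def t2 sum.distrib sum_subtractf right_diff_distrib mult.commute)
qed

text \<open>\<open>X\<close> is differentiated only by \<open>Y p\<close>, which sees germs;
  elsewhere it enters through its value at \<open>p\<close>.\<close>

lemma ext_deriv_cong:
  assumes X: "vector_field \<A> X" and X': "vector_field \<A> X'" and Y: "vector_field \<A> Y"
    and "open W" "p \<in> W" and eq: "\<And>q. q \<in> W \<Longrightarrow> X q = X' q"
  shows "ext_deriv \<alpha> X Y p = ext_deriv \<alpha> X' Y p"
proof -
  note YT = vector_field_tangent[OF Y]
  have ev: "\<forall>\<^sub>F q in nhds p. q \<in> W" using assms(4,5) by (rule eventually_nhds_in_open)
  have "Y p (\<lambda>q. \<alpha> q (X q)) = Y p (\<lambda>q. \<alpha> q (X' q))"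
    by (rule tangent_cong[OF YT form_smooth[OF X] form_smooth[OF X'] eventually_mono[OF ev]])
      (simp add: eq)
  moreover have "lie_bracket X Y p f = lie_bracket X' Y p f" for f
  proof -
    have "Y p (\<lambda>q. X q f) = Y p (\<lambda>q. X' q f)"
    proof (cases "smooth_fun \<A> f")
      case True
      show ?thesis
        by (rule tangent_cong[OF YT vector_field_smooth[OF X True] vector_field_smooth[OF X' True]
              eventually_mono[OF ev]]) (simp add: eq)
    next
      case False
      then show ?thesis
        by (simp add: tangent_not_smooth[OF vector_field_tangent[OF X]]
            tangent_not_smooth[OF vector_field_tangent[OF X']])
    qed
    then show ?thesis using eq[OF assms(5)] by (simp add: lie_bracket_def)
  qed
  then have "lie_bracket X Y p = lie_bracket X' Y p" by blast
  ultimately show ?thesis using eq[OF assms(5)] by (simp add: ext_deriv_def)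
qed

text \<open>The numbers \<open>c i\<close> relate the fields at \<open>p\<close> only, so linearity
  over functions does not apply to them directly. Expanding each field in a coordinate frame with
  smooth coefficients expresses \<open>ext_deriv\<close> at \<open>p\<close> through the values of
  the field at \<open>p\<close> on the coordinate functions, and these are linear in the tangent
  vector.\<close>

lemma ext_deriv_tensorial:
  assumes I: "finite I" and X: "vector_field \<A> X" and X': "\<And>i. i \<in> I \<Longrightarrow> vector_field \<A> (X' i)"
    and Y: "vector_field \<A> Y" and eq: "\<And>f. X p f = (\<Sum>i\<in>I. c i * X' i p f)"
  shows "ext_deriv \<alpha> X Y p = (\<Sum>i\<in>I. c i * ext_deriv \<alpha> (X' i) Y p)"
proof -
  obtain E :: "'e \<Rightarrow> 'a vfield" and x :: "'a \<Rightarrow> 'e" and W where W: "open W" "p \<in> W"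
    and E: "\<And>b. vector_field \<A> (E b)" and x: "smooth_fun \<A> x"
    and frame: "\<And>q v. q \<in> W \<Longrightarrow> v \<in> tangent_space \<A> q \<Longrightarrow> v = (\<lambda>f. \<Sum>b\<in>Basis. v (\<lambda>z. x z \<bullet> b) * E b q f)"
    by (rule ex_local_frame[of p], rule that)
  have exp: "ext_deriv \<alpha> V Y p = (\<Sum>b\<in>Basis. V p (\<lambda>z. x z \<bullet> b) * ext_deriv \<alpha> (E b) Y p)"
    if V: "vector_field \<A> V" for V
  proof -
    have s: "smooth_fun \<A> (\<lambda>q. V q (\<lambda>z. x z \<bullet> b))" for b
      by (rule vector_field_smooth[OF V smooth_fun_inner[OF x]])
    have "ext_deriv \<alpha> V Y p = ext_deriv \<alpha> (\<lambda>q f. \<Sum>b\<in>Basis. V q (\<lambda>z. x z \<bullet> b) * E b q f) Y p"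
    proof (rule ext_deriv_cong[OF V _ Y W])
      show "vector_field \<A> (\<lambda>q f. \<Sum>b\<in>Basis. V q (\<lambda>z. x z \<bullet> b) * E b q f)"
        by (rule vector_field_combination[OF finite_Basis E s])
      show "V q = (\<lambda>f. \<Sum>b\<in>Basis. V q (\<lambda>z. x z \<bullet> b) * E b q f)" if "q \<in> W" for q
        by (rule frame[OF that vector_field_tangent[OF V]])
    qed
    also have "\<dots> = (\<Sum>b\<in>Basis. V p (\<lambda>z. x z \<bullet> b) * ext_deriv \<alpha> (E b) Y p)"
      by (rule ext_deriv_combination[OF finite_Basis E s Y])
    finally show ?thesis .
  qed
  have "ext_deriv \<alpha> X Y p = (\<Sum>b\<in>Basis. \<Sum>i\<in>I. c i * (X' i p (\<lambda>z. x z \<bullet> b) * ext_deriv \<alpha> (E b) Y p))"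
    by (simp add: exp[OF X] eq sum_distrib_right mult.assoc)
  also have "\<dots> = (\<Sum>i\<in>I. c i * (\<Sum>b\<in>Basis. X' i p (\<lambda>z. x z \<bullet> b) * ext_deriv \<alpha> (E b) Y p))"
    by (subst sum.swap) (simp add: sum_distrib_left)
  also have "\<dots> = (\<Sum>i\<in>I. c i * ext_deriv \<alpha> (X' i) Y p)"
    by (rule sum.cong[OF refl]) (simp add: exp X')
  finally show ?thesis .
qed

end

section \<open>Linear algebra and index sets for the frame\<close>

lemma independent_family_spans:
  fixes w :: "'i \<Rightarrow> 'e::euclidean_space"
  assumes "finite I" and "card I = DIM('e)"
    and ind: "\<And>c. (\<Sum>i\<in>I. c i *\<^sub>R w i) = 0 \<Longrightarrow> \<forall>i\<in>I. c i = 0"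
  shows "\<exists>c. y = (\<Sum>i\<in>I. c i *\<^sub>R w i)"
proof -
  \<comment> \<open>\<open>independent\<close> concerns sets and would not notice a repeated vector,
    so repetitions are excluded beforehand: coefficients 1 and -1 at two indices with the same
    vector would be a nontrivial relation.\<close>
  have inj: "inj_on w I"
  proof (rule inj_onI, rule ccontr)
    fix i j assume ij: "i \<in> I" "j \<in> I" "w i = w j" "i \<noteq> j"
    let ?c = "\<lambda>k. (if k = i then 1 else 0) - (if k = j then 1 else 0) :: real"
    have "(\<Sum>k\<in>I. ?c k *\<^sub>R w k) =
        (\<Sum>k\<in>I. if k = i then w k else 0) - (\<Sum>k\<in>I. if k = j then w k else 0)"
      unfolding sum_subtractf[symmetric] by (rule sum.cong) auto
    also have "\<dots> = 0" using ij assms(1) by simp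
    finally show False using ind[of ?c] ij by auto
  qed
  have "independent (w ` I)"
    unfolding independent_explicit
  proof (intro conjI allI impI)
    show "finite (w ` I)" using assms(1) by simp
    fix c assume "(\<Sum>v\<in>w ` I. c v *\<^sub>R v) = 0"
    then have "(\<Sum>i\<in>I. c (w i) *\<^sub>R w i) = 0" by (simp add: sum.reindex[OF inj])
    then show "\<forall>v\<in>w ` I. c v = 0" using ind[of "\<lambda>i. c (w i)"] by simp
  qed
  then have "UNIV \<subseteq> span (w ` I)"
    by (rule card_ge_dim_independent[OF subset_UNIV]) (simp add: card_image[OF inj] assms(2))
  then have "y \<in> span (w ` I)" by blast
  then obtain c where "y = (\<Sum>v\<in>w ` I. c v *\<^sub>R v)"
    using assms(1) by (auto simp: span_finite)
  then have "y = (\<Sum>i\<in>I. c (w i) *\<^sub>R w i)" by (simp add: sum.reindex[OF inj])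
  then show ?thesis by (rule exI[of _ "\<lambda>i. c (w i)"])
qed

lemma sum_atMost_double:
  fixes g :: "nat \<Rightarrow> 'b::comm_monoid_add"
  shows "(\<Sum>k\<le>2 * n. g k) = g 0 + ((\<Sum>i=1..n. g i) + (\<Sum>i=1..n. g (n + i)))"
proof -
  have "{..2 * n} = insert 0 ({1..n} \<union> {1 + n..n + n})" by auto
  then have "(\<Sum>k\<le>2 * n. g k) = g 0 + ((\<Sum>i=1..n. g i) + (\<Sum>i=1 + n..n + n. g i))"
    by (simp add: sum.union_disjoint)
  moreover have "(\<Sum>i=1 + n..n + n. g i) = (\<Sum>i=1..n. g (n + i))"
    unfolding sum.shift_bounds_cl_nat_ivl by (rule sum.cong[OF refl]) (simp add: add.commute)
  ultimately show ?thesis by simp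
qed

lemma le_double_cases:
  fixes k n :: nat
  assumes "k \<le> 2 * n"
  obtains "k = 0" | "k \<in> {1..n}" | i where "i \<in> {1..n}" and "k = n + i"
proof -
  consider "k = 0" | "k \<in> {1..n}" | "k - n \<in> {1..n}" "k = n + (k - n)" using assms by force
  then show thesis by cases (use that in blast)+
qed

section \<open>The Heisenberg frame\<close>

locale heisenberg_manifold = manifold_one_form \<A> \<alpha>
  for \<A> :: "('a::{t2_space, second_countable_topology}, 'e::euclidean_space) chart set"
    and \<alpha> :: "'a form1" +
  fixes n :: nat and A B :: "nat \<Rightarrow> 'a vfield" and Z :: "'a vfield"
  assumes dim: "DIM('e) = 2 * n + 1"
    and heisenberg: "heisenberg_structure \<A> n \<alpha> A B Z"
begin

lemma fields: "vector_field \<A> Z" "i \<in> {1..n} \<Longrightarrow> vector_field \<A> (A i)"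
    "i \<in> {1..n} \<Longrightarrow> vector_field \<A> (B i)"
  and form_values: "\<alpha> p (Z p) = 1" "i \<in> {1..n} \<Longrightarrow> \<alpha> p (A i p) = 0" "i \<in> {1..n} \<Longrightarrow> \<alpha> p (B i p) = 0"
  and ext_deriv_Z: "vector_field \<A> Y \<Longrightarrow> ext_deriv \<alpha> Z Y p = 0"
  and brackets: "i \<in> {1..n} \<Longrightarrow> j \<in> {1..n} \<Longrightarrow> lie_bracket (A i) (B j) = (if i = j then Z else (\<lambda>p f. 0))"
    "i \<in> {1..n} \<Longrightarrow> j \<in> {1..n} \<Longrightarrow> lie_bracket (A i) (A j) = (\<lambda>p f. 0)"
    "i \<in> {1..n} \<Longrightarrow> j \<in> {1..n} \<Longrightarrow> lie_bracket (B i) (B j) = (\<lambda>p f. 0)"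
  using heisenberg unfolding heisenberg_structure_def reeb_field_def contact_structure_def by blast+

lemma horizontal_independent:
  assumes "\<And>f. (\<Sum>i=1..n. a i * A i p f + b i * B i p f) = 0" and "i \<in> {1..n}"
  shows "a i = 0" and "b i = 0"
  using heisenberg assms unfolding heisenberg_structure_def by blast+

lemma ext_deriv_values:
  assumes i: "i \<in> {1..n}" and j: "j \<in> {1..n}"
  shows "ext_deriv \<alpha> (A i) (A j) p = 0" and "ext_deriv \<alpha> (B i) (B j) p = 0"
    and "ext_deriv \<alpha> (A i) (B j) p = (if i = j then - 1 else 0)"
    and "ext_deriv \<alpha> (B i) (A j) p = (if i = j then 1 else 0)"
proof -
  have c: "X p (\<lambda>q. 0) = 0" if "vector_field \<A> X" for X
    by (rule tangent_const[OF vector_field_tangent[OF that]])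
  show "ext_deriv \<alpha> (A i) (A j) p = 0" and "ext_deriv \<alpha> (B i) (B j) p = 0"
    using i j by (simp_all add: ext_deriv_def form_values brackets c fields form_zero)
  have AB: "ext_deriv \<alpha> (A i) (B j) p = (if i = j then - 1 else 0)" if "i \<in> {1..n}" "j \<in> {1..n}" for i j
    using that by (simp add: ext_deriv_def form_values brackets c fields form_zero)
  then show "ext_deriv \<alpha> (A i) (B j) p = (if i = j then - 1 else 0)" using i j by blast
  show "ext_deriv \<alpha> (B i) (A j) p = (if i = j then 1 else 0)"
    using ext_deriv_skew[OF fields(3)[OF i] fields(2)[OF j]] AB[OF j i] by simp
qed

text \<open>A single index set \<open>{..2 * n}\<close> lets the lemmas on finite combinations treat
  \<open>Z\<close>, \<open>A\<close> and \<open>B\<close> at once. Index 0 goes to \<open>Z\<close>,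
  so the coefficient there is the value of \<alpha>.\<close>

definition frame :: "nat \<Rightarrow> 'a vfield" where
  "frame k = (if k = 0 then Z else if k \<le> n then A k else B (k - n))"

lemma frame_simps [simp]:
  "frame 0 = Z" "i \<in> {1..n} \<Longrightarrow> frame i = A i" "i \<in> {1..n} \<Longrightarrow> frame (n + i) = B i"
  by (auto simp: frame_def)

lemma sum_frame:
  "(\<Sum>k\<le>2 * n. c k * h (frame k)) =
    c 0 * h Z + ((\<Sum>i=1..n. c i * h (A i)) + (\<Sum>i=1..n. c (n + i) * h (B i)))"
  for h :: "'a vfield \<Rightarrow> real"
  by (simp add: sum_atMost_double)

lemma vector_field_frame: "k \<le> 2 * n \<Longrightarrow> vector_field \<A> (frame k)"
  by (erule le_double_cases) (auto simp: fields)

lemmas frame_tangent = vector_field_tangent[OF vector_field_frame]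

lemma form_frame_combination:
  "\<alpha> p (\<lambda>f. \<Sum>k\<le>2 * n. c k * frame k p f) = c 0"
proof -
  have "\<alpha> p (\<lambda>f. \<Sum>k\<le>2 * n. c k * frame k p f) = (\<Sum>k\<le>2 * n. c k * \<alpha> p (frame k p))"
    by (rule form_combination) (auto intro: frame_tangent)
  then show ?thesis
    using sum_frame[of c "\<lambda>X. \<alpha> p (X p)"] by (simp add: form_values)
qed

text \<open>\<open>J\<close> records the values of a tangent vector on the coordinate functions and
  is injective on the tangent space. The \<open>2 * n + 1\<close> images of the frame are
  independent: applying \<alpha> to a relation forces the coefficient of \<open>Z\<close> to be 0,
  and what remains is a relation among the \<open>A i\<close> and \<open>B i\<close>. Being as many
  as the dimension, the images span, and injectivity carries the expansion back.\<close>

lemma frame_spans: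
  assumes v: "v \<in> tangent_space \<A> p"
  shows "\<exists>c. \<forall>f. v f = (\<Sum>k\<le>2 * n. c k * frame k p f)"
proof -
  obtain E :: "'e \<Rightarrow> 'a vfield" and x :: "'a \<Rightarrow> 'e" and W where "p \<in> W" and
    exp: "\<And>q v. q \<in> W \<Longrightarrow> v \<in> tangent_space \<A> q \<Longrightarrow> v = (\<lambda>f. \<Sum>b\<in>Basis. v (\<lambda>z. x z \<bullet> b) * E b q f)"
    by (rule ex_local_frame[of p], rule that)
  have eq0: "u = u'" if "u \<in> tangent_space \<A> p" "u' \<in> tangent_space \<A> p"
    "\<And>b. b \<in> Basis \<Longrightarrow> u (\<lambda>z. x z \<bullet> b) = u' (\<lambda>z. x z \<bullet> b)" for u u'
    by (subst exp[OF \<open>p \<in> W\<close> that(1)], subst exp[OF \<open>p \<in> W\<close> that(2)]) (simp add: that(3))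
  define J :: "'a tangent \<Rightarrow> 'e" where "J u = (\<Sum>b\<in>Basis. u (\<lambda>z. x z \<bullet> b) *\<^sub>R b)" for u
  have J: "J u \<bullet> b = u (\<lambda>z. x z \<bullet> b)" if "b \<in> Basis" for u b
    using that by (simp add: J_def inner_sum_left inner_Basis if_distrib sum.delta cong: if_cong)
  have comb: "(\<lambda>f. \<Sum>k\<le>2 * n. c k * frame k p f) \<in> tangent_space \<A> p" for c
    by (rule tangent_combination) (auto intro: frame_tangent)
  have "\<exists>c. J v = (\<Sum>k\<le>2 * n. c k *\<^sub>R J (frame k p))"
  proof (rule independent_family_spans)
    show "card {..2 * n} = DIM('e)" using dim by simp
    fix c assume "(\<Sum>k\<le>2 * n. c k *\<^sub>R J (frame k p)) = 0"
    then have J0: "(\<Sum>k\<le>2 * n. c k *\<^sub>R J (frame k p)) \<bullet> b = 0" for b by simp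
    have "(\<Sum>k\<le>2 * n. c k * frame k p (\<lambda>z. x z \<bullet> b)) = 0" if "b \<in> Basis" for b
      using J0[of b] by (simp add: inner_sum_left J[OF that])
    then have 0: "(\<lambda>f. \<Sum>k\<le>2 * n. c k * frame k p f) = (\<lambda>f. 0)"
      by (intro eq0 comb) (simp_all add: tangent_space_def)
    then have c0: "c 0 = 0" using form_frame_combination[of p c] form_zero by simp
    have "(\<Sum>i=1..n. c i * A i p f + c (n + i) * B i p f) = 0" for f
      using fun_cong[OF 0, of f] sum_frame[of c "\<lambda>X. X p f"] c0 by (simp add: sum.distrib)
    then have c1: "c i = 0" "c (n + i) = 0" if "i \<in> {1..n}" for i
      using horizontal_independent[of c p "\<lambda>i. c (n + i)" i] that by blast+
    show "\<forall>k\<in>{..2 * n}. c k = 0"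
    proof
      fix k assume k: "k \<in> {..2 * n}"
      then show "c k = 0" using c0 c1 by (auto elim!: le_double_cases)
    qed
  qed simp
  then obtain c where c: "J v = (\<Sum>k\<le>2 * n. c k *\<^sub>R J (frame k p))" by blast
  have "v = (\<lambda>f. \<Sum>k\<le>2 * n. c k * frame k p f)"
  proof (rule eq0[OF v comb])
    fix b :: 'e assume b: "b \<in> Basis"
    have "J v \<bullet> b = (\<Sum>k\<le>2 * n. c k * (J (frame k p) \<bullet> b))"
      unfolding c by (simp add: inner_sum_left)
    then show "v (\<lambda>z. x z \<bullet> b) = (\<Sum>k\<le>2 * n. c k * frame k p (\<lambda>z. x z \<bullet> b))"
      by (simp only: J[OF b])
  qed
  then show ?thesis by (metis (no_types))
qed

text \<open>The term of index 0 drops out because the Reeb field lies in the kernel of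
  d\<alpha>.\<close>

lemma ext_deriv_frame_combination:
  assumes X: "vector_field \<A> X" and Y: "vector_field \<A> Y"
    and "\<And>f. X p f = (\<Sum>k\<le>2 * n. c k * frame k p f)"
  shows "ext_deriv \<alpha> X Y p =
    (\<Sum>i=1..n. c i * ext_deriv \<alpha> (A i) Y p) + (\<Sum>i=1..n. c (n + i) * ext_deriv \<alpha> (B i) Y p)"
proof -
  have "ext_deriv \<alpha> X Y p = (\<Sum>k\<le>2 * n. c k * ext_deriv \<alpha> (frame k) Y p)"
    by (rule ext_deriv_tensorial[OF _ X vector_field_frame Y assms(3)]) auto
  then show ?thesis
    using sum_frame[of c "\<lambda>V. ext_deriv \<alpha> V Y p"] ext_deriv_Z[OF Y] by simp
qed

text \<open>Up to sign the \<open>A i\<close> and \<open>B i\<close> form a symplectic basis of the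
  contact distribution, so pairing with \<open>A j\<close> isolates the coefficient of
  \<open>B j\<close>, and pairing with \<open>B j\<close> that of \<open>A j\<close>.\<close>

lemma ext_deriv_horizontal:
  assumes X: "vector_field \<A> X" and c: "\<And>f. X p f = (\<Sum>k\<le>2 * n. c k * frame k p f)"
    and j: "j \<in> {1..n}"
  shows "ext_deriv \<alpha> X (A j) p = c (n + j)" and "ext_deriv \<alpha> X (B j) p = - c j"
proof -
  have "(\<Sum>i=1..n. c (n + i) * ext_deriv \<alpha> (B i) (A j) p) = (\<Sum>i=1..n. if i = j then c (n + i) else 0)"
    by (rule sum.cong) (use j in \<open>auto simp: ext_deriv_values\<close>)
  moreover have "(\<Sum>i=1..n. c i * ext_deriv \<alpha> (A i) (A j) p) = 0"
    by (rule sum.neutral) (use j in \<open>auto simp: ext_deriv_values\<close>)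
  ultimately show "ext_deriv \<alpha> X (A j) p = c (n + j)"
    using ext_deriv_frame_combination[OF X fields(2)[OF j] c] j by simp
  have "(\<Sum>i=1..n. c i * ext_deriv \<alpha> (A i) (B j) p) = (\<Sum>i=1..n. if i = j then - c i else 0)"
    by (rule sum.cong) (use j in \<open>auto simp: ext_deriv_values\<close>)
  moreover have "(\<Sum>i=1..n. c (n + i) * ext_deriv \<alpha> (B i) (B j) p) = 0"
    by (rule sum.neutral) (use j in \<open>auto simp: ext_deriv_values\<close>)
  ultimately show "ext_deriv \<alpha> X (B j) p = - c j"
    using ext_deriv_frame_combination[OF X fields(3)[OF j] c] j by simp
qed

section \<open>Contact fields and their Hamiltonians\<close>

lemma lie_deriv_real_eq:
  "lie_deriv_real X \<alpha> Y p = ext_deriv \<alpha> X Y p + Y p (\<lambda>q. \<alpha> q (X q))"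
  by (simp add: lie_deriv_real_def ext_deriv_def)

text \<open>The formula of the theorem is real-linear in the Hamiltonian; its real and imaginary
  parts are fields of this shape, taken for the real and the imaginary part of the complex
  Hamiltonian.\<close>

definition hamiltonian_field :: "('a \<Rightarrow> real) \<Rightarrow> 'a vfield" where
  "hamiltonian_field H p f = H p * Z p f - (\<Sum>i=1..n. A i p H * B i p f - B i p H * A i p f)"

definition hamiltonian_coeff :: "('a \<Rightarrow> real) \<Rightarrow> nat \<Rightarrow> 'a \<Rightarrow> real" where
  "hamiltonian_coeff H k p = (if k = 0 then H p else if k \<le> n then B k p H else - A (k - n) p H)"

lemma hamiltonian_coeff_simps:
  "hamiltonian_coeff H 0 p = H p"
  "i \<in> {1..n} \<Longrightarrow> hamiltonian_coeff H i p = B i p H"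
  "i \<in> {1..n} \<Longrightarrow> hamiltonian_coeff H (n + i) p = - A i p H"
  by (auto simp: hamiltonian_coeff_def)

lemma hamiltonian_field_frame:
  "hamiltonian_field H p f = (\<Sum>k\<le>2 * n. hamiltonian_coeff H k p * frame k p f)"
  using sum_frame[of "\<lambda>k. hamiltonian_coeff H k p" "\<lambda>X. X p f"]
  by (simp add: hamiltonian_coeff_simps hamiltonian_field_def sum_subtractf sum_negf)

lemma hamiltonian_field_unique:
  assumes X: "vector_field \<A> X"
    and contact: "\<And>Y p. vector_field \<A> Y \<Longrightarrow> lie_deriv_real X \<alpha> Y p = h p * \<alpha> p (Y p)"
  shows "X = hamiltonian_field (\<lambda>p. \<alpha> p (X p))"
proof (intro ext)
  fix p f
  let ?H = "\<lambda>p. \<alpha> p (X p)"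
  obtain c where c: "\<And>f. X p f = (\<Sum>k\<le>2 * n. c k * frame k p f)"
    using frame_spans[OF vector_field_tangent[OF X]] by blast
  have c0: "c 0 = ?H p"
  proof -
    have "X p = (\<lambda>f. \<Sum>k\<le>2 * n. c k * frame k p f)" using c by (rule ext)
    then show ?thesis using form_frame_combination[of p c] by simp
  qed
  \<comment> \<open>Since \<alpha> vanishes on \<open>A i\<close> and \<open>B i\<close>, the
    unknown factor \<open>h\<close> disappears from the contact condition there: pairing
    \<open>X\<close> with either of them under d\<alpha> yields minus its derivative of
    \<open>?H\<close>.\<close>
  have c1: "c i = B i p ?H" "c (n + i) = - A i p ?H" if i: "i \<in> {1..n}" for i
    using contact[OF fields(2)[OF i], of p] contact[OF fields(3)[OF i], of p]
      ext_deriv_horizontal[OF X c i] form_values(2,3)[OF i]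
    by (simp_all add: lie_deriv_real_eq)
  have "X p f = c 0 * Z p f + ((\<Sum>i=1..n. c i * A i p f) + (\<Sum>i=1..n. c (n + i) * B i p f))"
    using c[of f] sum_frame[of c "\<lambda>V. V p f"] by simp
  also have "\<dots> = hamiltonian_field ?H p f"
    by (simp add: c0 c1 hamiltonian_field_def sum_subtractf sum_negf)
  finally show "X p f = hamiltonian_field ?H p f" .
qed

lemma hamiltonian_field_contact:
  assumes H: "smooth_fun \<A> H"
  shows "vector_field \<A> (hamiltonian_field H)" and "\<alpha> p (hamiltonian_field H p) = H p"
    and "vector_field \<A> Y \<Longrightarrow> lie_deriv_real (hamiltonian_field H) \<alpha> Y p = Z p H * \<alpha> p (Y p)"
proof -
  let ?c = "hamiltonian_coeff H"
  have sm: "smooth_fun \<A> (\<lambda>p. ?c k p)" if "k \<le> 2 * n" for k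
    using that
  proof (cases rule: le_double_cases)
    case 1
    then show ?thesis using H by (simp add: hamiltonian_coeff_simps)
  next
    case 2
    then show ?thesis using vector_field_smooth[OF fields(3) H] by (simp add: hamiltonian_coeff_simps)
  next
    case (3 i)
    then show ?thesis
      using smooth_fun_minus[OF vector_field_smooth[OF fields(2) H]] by (simp add: hamiltonian_coeff_simps)
  qed
  have eq: "hamiltonian_field H = (\<lambda>q f. \<Sum>k\<le>2 * n. ?c k q * frame k q f)"
    by (intro ext) (rule hamiltonian_field_frame)
  show X: "vector_field \<A> (hamiltonian_field H)"
    unfolding eq by (rule vector_field_combination) (auto intro: sm vector_field_frame)
  show a: "\<alpha> p (hamiltonian_field H p) = H p" for p
    unfolding eq form_frame_combination by (rule hamiltonian_coeff_simps)
  assume Y: "vector_field \<A> Y"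
  obtain a where a': "\<And>f. Y p f = (\<Sum>k\<le>2 * n. a k * frame k p f)"
    using frame_spans[OF vector_field_tangent[OF Y]] by blast
  have a0: "\<alpha> p (Y p) = a 0"
  proof -
    have "Y p = (\<lambda>f. \<Sum>k\<le>2 * n. a k * frame k p f)" using a' by (rule ext)
    then show ?thesis using form_frame_combination[of p a] by simp
  qed
  have "ext_deriv \<alpha> (hamiltonian_field H) Y p =
      (\<Sum>i=1..n. ?c i p * ext_deriv \<alpha> (A i) Y p) + (\<Sum>i=1..n. ?c (n + i) p * ext_deriv \<alpha> (B i) Y p)"
    by (rule ext_deriv_frame_combination[OF X Y hamiltonian_field_frame])
  also have "\<dots> = - (\<Sum>i=1..n. a (n + i) * B i p H) - (\<Sum>i=1..n. a i * A i p H)"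
    using ext_deriv_skew[OF fields(2) Y] ext_deriv_skew[OF fields(3) Y] ext_deriv_horizontal[OF Y a']
    by (simp add: hamiltonian_coeff_simps sum_negf mult.commute)
  \<comment> \<open>The two sums are minus the part of \<open>Y p H\<close> along the
    \<open>A i\<close> and \<open>B i\<close>. Adding \<open>Y p H\<close>, the second term of the
    Lie derivative, leaves \<open>a 0 * Z p H\<close>: hence the factor
    \<open>Z p H\<close>.\<close>
  finally show "lie_deriv_real (hamiltonian_field H) \<alpha> Y p = Z p H * \<alpha> p (Y p)"
    using a'[of H] sum_frame[of a "\<lambda>V. V p H"] a0 by (simp add: lie_deriv_real_eq a)
qed

end

text \<open>Unique existence is part of the conclusion because \<open>contact_field_of\<close> is a
  definite description: it is what gives the equation its intended meaning.\<close>

theorem proposition5p3: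
  fixes \<A> :: "('a::{t2_space, second_countable_topology}, 'e::euclidean_space) chart set"
    and n :: nat
    and \<alpha> :: "'a form1"
    and A B :: "nat \<Rightarrow> 'a vfield"
    and Z :: "'a vfield"
    and H :: "'a \<Rightarrow> complex"
  assumes "smooth_atlas \<A>"
    and "DIM('e) = 2 * n + 1"
    and "n \<ge> 1"
    and "heisenberg_structure \<A> n \<alpha> A B Z"
    and "smooth_fun \<A> H"
  shows "(\<exists>!X. contact_vector_field \<A> \<alpha> X \<and> contact_hamiltonian \<alpha> X = H) \<and>
    contact_field_of \<A> \<alpha> H =
      (\<lambda>p f. H p * of_real (Z p f) -
        (\<Sum>i=1..n. apply_field (A i) H p * of_real (B i p f)
                 - apply_field (B i) H p * of_real (A i p f)))"
proof -
  interpret heisenberg_manifold \<A> \<alpha> n A B Z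
    by unfold_locales (use assms in \<open>simp_all add: heisenberg_structure_def contact_form_def\<close>)
  let ?P = "\<lambda>X. contact_vector_field \<A> \<alpha> X \<and> contact_hamiltonian \<alpha> X = H"
  let ?R = "\<lambda>q. Re (H q)" and ?I = "\<lambda>q. Im (H q)"
  define F :: "'a cvfield" where "F = (\<lambda>p f. H p * of_real (Z p f) -
        (\<Sum>i=1..n. apply_field (A i) H p * of_real (B i p f)
                 - apply_field (B i) H p * of_real (A i p f)))"
  have R: "smooth_fun \<A> ?R" and I: "smooth_fun \<A> ?I"
    by (rule smooth_fun_linear[OF bounded_linear_Re assms(5)],
        rule smooth_fun_linear[OF bounded_linear_Im assms(5)])
  have ReF: "Re_field F = hamiltonian_field ?R" and ImF: "Im_field F = hamiltonian_field ?I"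
    by (simp_all add: fun_eq_iff Re_field_def Im_field_def F_def hamiltonian_field_def apply_field_def)
  have PF: "?P F"
    unfolding contact_vector_field_def complex_vector_field_def contact_hamiltonian_def ReF ImF lie_deriv_def
  proof (intro conjI exI allI impI)
    show "vector_field \<A> (hamiltonian_field ?R)" "vector_field \<A> (hamiltonian_field ?I)"
      by (rule hamiltonian_field_contact[OF R], rule hamiltonian_field_contact[OF I])
    \<comment> \<open>The witness for the complex factor is Z(H). As \<alpha>(Y) is real, the
      complex condition amounts to two real ones.\<close>
    show "Complex (lie_deriv_real (hamiltonian_field ?R) \<alpha> Y p) (lie_deriv_real (hamiltonian_field ?I) \<alpha> Y p) =
        Complex (Z p ?R) (Z p ?I) * of_real (\<alpha> p (Y p))" if "vector_field \<A> Y" for Y p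
      using hamiltonian_field_contact(3)[OF R that, of p] hamiltonian_field_contact(3)[OF I that, of p]
      by (simp add: complex_eq_iff)
    show "(\<lambda>p. Complex (\<alpha> p (hamiltonian_field ?R p)) (\<alpha> p (hamiltonian_field ?I p))) = H"
      by (simp add: hamiltonian_field_contact(2)[OF R] hamiltonian_field_contact(2)[OF I])
  qed
  have uniq: "X = F" if X: "?P X" for X
  proof -
    obtain h where h: "\<And>Y p. vector_field \<A> Y \<Longrightarrow> lie_deriv X \<alpha> Y p = h p * of_real (\<alpha> p (Y p))"
      and f: "vector_field \<A> (Re_field X)" "vector_field \<A> (Im_field X)"
      using X unfolding contact_vector_field_def complex_vector_field_def by blast
    have H: "\<alpha> p (Re_field X p) = Re (H p)" "\<alpha> p (Im_field X p) = Im (H p)" for p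
      using X by (auto simp: contact_hamiltonian_def)
    \<comment> \<open>Multiplication by the real number \<alpha>(Y) respects real and imaginary
      parts, so \<open>Re (h p)\<close> and \<open>Im (h p)\<close> are the factors for the two real
      fields.\<close>
    have "Re_field X = hamiltonian_field (\<lambda>p. \<alpha> p (Re_field X p))"
      by (rule hamiltonian_field_unique[OF f(1), of "\<lambda>p. Re (h p)"])
        (use h in \<open>simp add: lie_deriv_def complex_eq_iff\<close>)
    moreover have "Im_field X = hamiltonian_field (\<lambda>p. \<alpha> p (Im_field X p))"
      by (rule hamiltonian_field_unique[OF f(2), of "\<lambda>p. Im (h p)"])
        (use h in \<open>simp add: lie_deriv_def complex_eq_iff\<close>)
    ultimately have "Re_field X = Re_field F" "Im_field X = Im_field F"
      unfolding ReF ImF H by auto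
    then show ?thesis
      by (auto simp: Re_field_def Im_field_def fun_eq_iff complex_eq_iff)
  qed
  have "\<exists>!X. ?P X" using PF uniq by (rule ex1I)
  moreover have "contact_field_of \<A> \<alpha> H = F"
    unfolding contact_field_of_def using PF uniq by (rule the_equality)
  ultimately show ?thesis unfolding F_def by (rule conjI)
qed

end
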